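(* Let $p=p(n)\in[0,1]$ be arbitrary, let $G=G(n,p)$ be the binomial random graph, let $\Delta=\Delta(G)$ be its maximum degree, and let $\lambda_1(G)$ be the largest eigenvalue of the adjacency matrix of $G$. Then almost surely $$\lambda_1(G)=(1+o(1))\max\big\{\sqrt{\Delta},\,np\big\},$$ where the $o(1)$ term tends to zero as $\max\{\sqrt{\Delta},np\}$ tends to infinity.
   Context: $G(n,p)$ is the random graph on vertex set $\{1,\dots,n\}$ in which each of the $\binom n2$ possible edges appears independently with probability $p$. The adjacency matrix $A(G)$ is the $n\times n$ symmetric $0/1$ matrix with $A_{ij}=1$ iff $\{i,j\}$ is an edge. A property holds almost surely (a.s.) if its probability tends to $1$ as $n\to\infty$. *)

theory Defs
  imports "HOL-Probability.Probability"
    "Jordan_Normal_Form.Char_Poly"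
begin

text \<open>A simple graph on the vertex set \<open>{1..n}\<close> is represented by its set of edges, each edge
  being a two-element set of vertices.\<close>

definition possible_edges :: "nat \<Rightarrow> nat set set" where
  "possible_edges n = {e. e \<subseteq> {1..n} \<and> card e = 2}"

definition gnp :: "nat \<Rightarrow> real \<Rightarrow> nat set set pmf" where
  "gnp n p = map_pmf (\<lambda>f. {e \<in> possible_edges n. f e})
     (Pi_pmf (possible_edges n) False (\<lambda>_. bernoulli_pmf p))"

definition max_degree :: "nat \<Rightarrow> nat set set \<Rightarrow> nat" where
  "max_degree n E = Max ((\<lambda>v. card {e \<in> E. v \<in> e}) ` {1..n})"

text \<open>Matrix indices start at 0, so row \<open>i\<close> belongs to vertex \<open>i + 1\<close>. Edges have two
  elements, so the diagonal is zero.\<close>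

definition adjacency_matrix :: "nat \<Rightarrow> nat set set \<Rightarrow> real Matrix.mat" where
  "adjacency_matrix n E = Matrix.mat n n (\<lambda>(i, j). if {i + 1, j + 1} \<in> E then 1 else 0)"

text \<open>The adjacency matrix is real symmetric, so its real eigenvalues are all its complex
  eigenvalues. For \<open>n = 0\<close> there are no eigenvalues and no degrees, and \<open>Max {}\<close> is unspecified;
  limits in \<open>n\<close> are not affected.\<close>

definition largest_eigenvalue :: "nat \<Rightarrow> nat set set \<Rightarrow> real" where
  "largest_eigenvalue n E = Max {k. eigenvalue (adjacency_matrix n E) k}"

end

theory Submission
  imports Defs "HOL-Real_Asymp.Real_Asymp"
begin

text \<open>Let \<open>x\<close> be the maximum of \<open>sqrt \<Delta>\<close> and \<open>d = n p\<close>. The lower bound on \<open>\<lambda>\<^sub>1\<close> comes from Rayleigh quotients: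
  a star gives \<open>sqrt \<Delta>\<close>, the constant vector gives the average degree, which is concentrated around \<open>d\<close>.

  For the upper bound it suffices, by Collatz and Wielandt, to find a positive vector \<open>w\<close> with
  \<open>A w \<le> (1 + \<eta>) x w\<close>. We perturb the constant vector by a weight on each vertex \<open>v\<close> proportional to
  the excess \<open>(deg v - (1 + \<eta>/2) x)\<^sup>+\<close>, and spread a fraction \<open>1/x\<close> of it to the neighbours of \<open>v\<close>.
  This works if any two vertices have at most two common neighbours and the total excess in each
  second neighbourhood is at most of order \<open>x^3\<close>. A union bound over trees of depth two shows that the
  total excess is \<open>O(ln n)\<close>, and even \<open>O(ln n / ln (1/d))\<close> for small \<open>d\<close>, with high probability.
  On the other hand \<open>\<Delta>\<close> is at least \<open>(ln n)^(4/5)\<close> for moderate \<open>d\<close> and of order \<open>ln n / ln (1/d)\<close>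
  for small \<open>d\<close>, so \<open>x^3\<close> dominates the excess. For \<open>d\<close> above a multiple of \<open>ln n\<close>
  the bound \<open>\<lambda>\<^sub>1 \<le> \<Delta>\<close> is enough.\<close>

section \<open>Rayleigh quotients and the Collatz--Wielandt bound\<close>

text \<open>Degrees far above \<open>x\<close> do occur, so the constant vector alone is no
  supersolution. A single star has largest eigenvalue at most \<open>x\<close>, but the stars around
  nearby vertices of high degree could reinforce each other. Walks of length two measure this: those
  returning to their start number at most \<open>x^2\<close>, and all others have to fit into the
  slack \<eta>. The random \<open>x\<close> cannot be the threshold inside a moment generating
  function, so a deterministic lower bound \<open>y\<close> replaces it; lower tails of the maximum
  degree are needed to make \<open>y\<close> large. The exponent 4/5 could be any number strictly
  between 2/3 and 1: above (ln n)^(2/3) the cube of sqrt \<Delta> exceeds ln n, whereas at d = 1 /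
  ln n the maximum degree is only of order ln n / ln ln n. As the error function may not depend on
  p, the estimates hold for all large n uniformly in p, with the threshold on the scale fixed by
  \<eta> before the probability of failure is chosen.\<close>

lemma quadratic_nonneg_imp_linear_zero:
  fixes b c :: real
  assumes "\<And>t. 0 \<le> c * t\<^sup>2 - 2 * b * t"
  shows "b = 0"
proof (rule ccontr)
  assume b: "b \<noteq> 0"
  define t where "t = b / (\<bar>c\<bar> + 1)"
  have t: "t * (\<bar>c\<bar> + 1) = b" by (simp add: t_def)
  have "c * t\<^sup>2 - 2 * b * t \<le> \<bar>c\<bar> * t\<^sup>2 - 2 * b * t"
    by (intro diff_right_mono mult_right_mono) auto
  also have "\<dots> = \<bar>c\<bar> * t\<^sup>2 - 2 * (t * (\<bar>c\<bar> + 1)) * t" by (simp only: t)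
  also have "\<dots> = - (\<bar>c\<bar> + 2) * t\<^sup>2" by (simp add: algebra_simps power2_eq_square)
  also have "\<dots> < 0" using b by (intro mult_neg_pos) (auto simp: t_def)
  finally show False using assms[of t] by simp
qed

text \<open>The quadratic form attains its maximum \<mu> on the compact unit sphere. At a maximizer
  \<open>z\<close> the residual \<open>c\<close> = a z - \<mu> z vanishes, since a small move in its
  direction would otherwise raise the Rayleigh quotient to first order.\<close>

lemma symmetric_rayleigh_maximizer:
  fixes a :: "nat \<Rightarrow> nat \<Rightarrow> real"
  assumes n: "n > 0" and sym: "\<And>i j. i < n \<Longrightarrow> j < n \<Longrightarrow> a i j = a j i"
  obtains z \<mu> where "(\<Sum>i<n. (z i)\<^sup>2) = 1"
    and "\<And>i. i < n \<Longrightarrow> (\<Sum>j<n. a i j * z j) = \<mu> * z i"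
    and "\<And>y. (\<Sum>i<n. \<Sum>j<n. a i j * y i * y j) \<le> \<mu> * (\<Sum>i<n. (y i)\<^sup>2)"
proof -
  define Q where "Q = (\<lambda>y :: nat \<Rightarrow> real. \<Sum>i<n. \<Sum>j<n. a i j * y i * y j)"
  define N where "N = (\<lambda>y :: nat \<Rightarrow> real. \<Sum>i<n. (y i)\<^sup>2)"
  \<comment> \<open>Vectors are functions on all naturals; pinning the coordinates from
    \<open>n\<close> on to 0 makes the sphere compact in the product topology.\<close>
  define B :: "(nat \<Rightarrow> real) set"
    where "B = PiE UNIV (\<lambda>i. if i < n then {-1..1} else {0})"
  have coord: "continuous_on A (\<lambda>y :: nat \<Rightarrow> real. y i)" for A i
    by (rule continuous_on_subset[OF continuous_on_product_coordinates]) simp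
  have contQ: "continuous_on A Q" and contN: "continuous_on A N" for A
    unfolding Q_def N_def by (intro continuous_on_sum continuous_on_mult continuous_on_power continuous_on_const coord)+
  have "compactin (product_topology (\<lambda>i. euclidean) UNIV) B"
    unfolding B_def compactin_PiE by (auto simp: compactin_euclidean_iff)
  hence "compact B"
    by (simp only: euclidean_product_topology compactin_euclidean_iff)
  moreover have "closed {y. N y = 1}"
    by (intro closed_Collect_eq contN continuous_on_const)
  ultimately have comp: "compact (B \<inter> {y. N y = 1})" by (rule compact_Int_closed)
  have "N (\<lambda>i. if i = 0 then 1 else 0) = (\<Sum>i<n. if i = 0 then 1 else 0)"
    unfolding N_def by (intro sum.cong) auto
  hence N1: "N (\<lambda>i. if i = 0 then 1 else 0) = 1" using n by simp
  have "(\<lambda>i. if i = 0 then 1 else 0) \<in> B \<inter> {y. N y = 1}"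
    using n by (auto simp: B_def N1)
  hence "B \<inter> {y. N y = 1} \<noteq> {}" by blast
  from continuous_attains_sup[OF comp this contQ]
  obtain z where z0: "z \<in> B \<inter> {y. N y = 1}" "\<forall>y\<in>B \<inter> {y. N y = 1}. Q y \<le> Q z"
    by (elim bexE)
  hence z: "z \<in> B" "N z = 1" by auto
  have zmax: "Q y \<le> Q z" if "y \<in> B" "N y = 1" for y
    using z0(2) that by simp
  define \<mu> where "\<mu> = Q z"
  have bound: "Q y \<le> \<mu> * N y" for y
  proof (cases "N y = 0")
    case True
    hence "\<forall>i<n. y i = 0" unfolding N_def by (subst (asm) sum_nonneg_eq_0_iff) auto
    hence "Q y = 0" unfolding Q_def by simp
    thus ?thesis using True by simp
  next
    case False
    have Npos: "N y > 0" using False by (simp add: N_def less_le sum_nonneg)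
    define r where "r = sqrt (N y)"
    have r: "r > 0" "r\<^sup>2 = N y" using Npos by (auto simp: r_def)
    define y' where "y' = (\<lambda>i. if i < n then y i / r else 0)"
    have "N y' = (\<Sum>i<n. (y i)\<^sup>2 / r\<^sup>2)"
      unfolding N_def y'_def by (intro sum.cong) (auto simp: power_divide)
    also have "\<dots> = N y / r\<^sup>2" by (simp add: N_def sum_divide_distrib)
    finally have N1: "N y' = 1" using r Npos by simp
    have "\<bar>y' i\<bar> \<le> 1" if "i < n" for i
    proof -
      have "(y' i)\<^sup>2 \<le> N y'" unfolding N_def using that
        by (intro member_le_sum) auto
      thus ?thesis using N1 by (simp add: abs_square_le_1)
    qed
    hence "-1 \<le> y' i \<and> y' i \<le> 1" if "i < n" for i
      using that by (smt (verit) abs_le_iff)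
    moreover have "y' i = 0" if "\<not> i < n" for i using that by (simp add: y'_def)
    ultimately have "y' \<in> B" unfolding B_def by auto
    hence "Q y' \<le> \<mu>" using zmax N1 by (simp add: \<mu>_def)
    moreover have "Q y' = Q y / r\<^sup>2"
      unfolding Q_def y'_def sum_divide_distrib
      by (intro sum.cong) (auto simp: power2_eq_square)
    ultimately show ?thesis using r Npos by (simp add: field_simps)
  qed
  define c where "c = (\<lambda>i. (\<Sum>j<n. a i j * z j) - \<mu> * z i)"
  define P where "P = (\<lambda>x y :: nat \<Rightarrow> real. \<Sum>i<n. \<Sum>j<n. a i j * x i * y j)"
  have Psym: "P x y = P y x" for x y
    unfolding P_def by (subst sum.swap) (auto intro!: sum.cong simp: sym mult_ac)
  have P_comb: "P (\<lambda>i. z i + t * c i) (\<lambda>i. z i + t * c i)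
      = P z z + t * P z c + t * P c z + t\<^sup>2 * P c c" for t
    unfolding P_def by (simp add: algebra_simps sum.distrib sum_distrib_left power2_eq_square)
  have N_comb: "N (\<lambda>i. z i + t * c i) = N z + 2 * t * (\<Sum>i<n. c i * z i) + t\<^sup>2 * N c" for t
    unfolding N_def by (simp add: algebra_simps sum.distrib sum_distrib_left power2_eq_square)
  have Pcz: "P c z = (\<Sum>i<n. c i * (\<Sum>j<n. a i j * z j))"
    unfolding P_def by (simp add: sum_distrib_left mult_ac)
  have "(\<Sum>i<n. c i * (\<Sum>j<n. a i j * z j)) - \<mu> * (\<Sum>i<n. c i * z i) = (\<Sum>i<n. c i * c i)"
    unfolding c_def
    by (simp add: sum_subtractf[symmetric] sum_distrib_left algebra_simps)
  hence lin: "P c z - \<mu> * (\<Sum>i<n. c i * z i) = N c"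
    by (simp add: Pcz N_def power2_eq_square)
  have QP: "Q y = P y y" for y by (simp add: Q_def P_def)
  \<comment> \<open>This is \<open>bound\<close> at z + t c. The constant terms cancel because
    \<open>Q z\<close> = \<mu> and \<open>N z\<close> = 1, and by \<open>lin\<close> the coefficient
    of t is a multiple of \<open>N c\<close>.\<close>
  have "0 \<le> (\<mu> * N c - P c c) * t\<^sup>2 - 2 * N c * t" for t
  proof -
    have "P z z + t * P z c + t * P c z + t\<^sup>2 * P c c
        \<le> \<mu> * (N z + 2 * t * (\<Sum>i<n. c i * z i) + t\<^sup>2 * N c)"
      using bound[of "\<lambda>i. z i + t * c i"] unfolding QP P_comb N_comb .
    moreover have "P z z = \<mu>" by (simp add: \<mu>_def QP)
    moreover have "P c z = N c + \<mu> * (\<Sum>i<n. c i * z i)" "P z c = P c z"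
      using lin Psym by auto
    ultimately show ?thesis using z(2) by (simp add: algebra_simps)
  qed
  hence "N c = 0" by (rule quadratic_nonneg_imp_linear_zero)
  hence "\<forall>i<n. c i = 0" unfolding N_def by (subst (asm) sum_nonneg_eq_0_iff) auto
  hence "\<And>i. i < n \<Longrightarrow> (\<Sum>j<n. a i j * z j) = \<mu> * z i" by (simp add: c_def)
  with z(2) bound show thesis unfolding N_def Q_def by (intro that[of z \<mu>])
qed

section \<open>Eigenvalues of the adjacency matrix as sums over vertices\<close>

lemma adjacency_eigenvector_iff:
  "eigenvector (adjacency_matrix n E) v k \<longleftrightarrow>
     dim_vec v = n \<and> (\<exists>i<n. vec_index v i \<noteq> 0) \<and>
     (\<forall>i<n. (\<Sum>j<n. (if {i + 1, j + 1} \<in> E then 1 else 0) * vec_index v j) = k * vec_index v i)"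
proof (cases "dim_vec v = n")
  case True
  have row: "vec_index (adjacency_matrix n E *\<^sub>v v) i
      = (\<Sum>j<n. (if {i + 1, j + 1} \<in> E then 1 else 0) * vec_index v j)" if "i < n" for i
    using that True unfolding lessThan_atLeast0
    by (auto simp: adjacency_matrix_def scalar_prod_def intro!: sum.cong)
  have dims: "dim_vec (adjacency_matrix n E *\<^sub>v v) = n" "dim_row (adjacency_matrix n E) = n"
    by (simp_all add: adjacency_matrix_def)
  have ext: "u = u' \<longleftrightarrow> (\<forall>i<n. vec_index u i = vec_index u' i)"
    if "dim_vec u = n" "dim_vec u' = n" for u u' :: "real Matrix.vec"
    using that by (auto intro: eq_vecI)
  have zero: "v = 0\<^sub>v n \<longleftrightarrow> (\<forall>i<n. vec_index v i = 0)"
    by (subst ext) (auto simp: True)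
  have eq: "adjacency_matrix n E *\<^sub>v v = k \<cdot>\<^sub>v v \<longleftrightarrow>
      (\<forall>i<n. vec_index (adjacency_matrix n E *\<^sub>v v) i = k * vec_index v i)"
    by (subst ext) (auto simp: True dims)
  have "(\<forall>i<n. vec_index (adjacency_matrix n E *\<^sub>v v) i = k * vec_index v i) \<longleftrightarrow>
      (\<forall>i<n. (\<Sum>j<n. (if {i + 1, j + 1} \<in> E then 1 else 0) * vec_index v j) = k * vec_index v i)"
    by (intro all_cong) (simp only: row)
  thus ?thesis unfolding eigenvector_def carrier_vec_def mem_Collect_eq dims zero eq
    by (simp only: True simp_thms not_all not_imp)
next
  case False
  have "dim_row (adjacency_matrix n E) = n" by (simp add: adjacency_matrix_def)
  with False show ?thesis unfolding eigenvector_def carrier_vec_def mem_Collect_eq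
    by (simp only: simp_thms)
qed

lemma finite_adjacency_eigenvalues: "finite {k. eigenvalue (adjacency_matrix n E) k}"
proof -
  have A: "adjacency_matrix n E \<in> carrier_mat n n" by (simp add: adjacency_matrix_def)
  have "coeff (char_poly (adjacency_matrix n E)) n = 1" using degree_monic_char_poly[OF A] by blast
  hence "char_poly (adjacency_matrix n E) \<noteq> 0" by auto
  thus ?thesis unfolding eigenvalue_root_char_poly[OF A] by (rule poly_roots_finite)
qed

lemma sum_lessThan_shift1: "(\<Sum>i<n. f (i + 1)) = (\<Sum>v\<in>{1..n :: nat}. f v)"
  by (rule sum.reindex_bij_witness[of _ "\<lambda>v. v - 1" "\<lambda>i. i + 1"]) auto

text \<open>The maximum \<mu> of the Rayleigh quotient is itself an eigenvalue. So the finite set of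
  eigenvalues is nonempty, its \<open>Max\<close> is meaningful, and \<mu> is at most this
  \<open>Max\<close>.\<close>

lemma largest_eigenvalue_max:
  assumes "n > 0"
  shows "eigenvalue (adjacency_matrix n E) (largest_eigenvalue n E)"
    and "(\<Sum>v\<in>{1..n}. \<Sum>u\<in>{1..n}. of_bool ({v, u} \<in> E) * y v * y u)
           \<le> largest_eigenvalue n E * (\<Sum>v\<in>{1..n}. (y v)\<^sup>2)"
proof -
  define a :: "nat \<Rightarrow> nat \<Rightarrow> real" where "a = (\<lambda>i j. of_bool ({i + 1, j + 1} \<in> E))"
  have sym: "a i j = a j i" for i j by (simp add: a_def insert_commute)
  obtain z \<mu> where
    z: "(\<Sum>i<n. (z i)\<^sup>2) = 1" "\<And>i. i < n \<Longrightarrow> (\<Sum>j<n. a i j * z j) = \<mu> * z i" and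
    max: "\<And>y. (\<Sum>i<n. \<Sum>j<n. a i j * y i * y j) \<le> \<mu> * (\<Sum>i<n. (y i)\<^sup>2)"
    by (rule symmetric_rayleigh_maximizer[of n a, OF assms sym]) blast
  have nz: "\<exists>i<n. z i \<noteq> 0"
  proof (rule ccontr)
    assume "\<not> ?thesis"
    thus False using z(1) by simp
  qed
  have "(\<Sum>j<n. (if {i + 1, j + 1} \<in> E then 1 else 0) * vec_index (vec n z) j)
      = \<mu> * vec_index (vec n z) i" if "i < n" for i
    using z(2)[OF that] that by (simp add: a_def of_bool_def)
  hence "eigenvector (adjacency_matrix n E) (vec n z) \<mu>"
    unfolding adjacency_eigenvector_iff using nz by auto
  hence ev: "eigenvalue (adjacency_matrix n E) \<mu>" by (auto simp: eigenvalue_def)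
  show "eigenvalue (adjacency_matrix n E) (largest_eigenvalue n E)"
    using Max_in[OF finite_adjacency_eigenvalues[of n E]] ev
    by (auto simp: largest_eigenvalue_def)
  have "\<mu> \<le> largest_eigenvalue n E"
    unfolding largest_eigenvalue_def using ev finite_adjacency_eigenvalues by (intro Max_ge) auto
  have "(\<Sum>v\<in>{1..n}. \<Sum>u\<in>{1..n}. of_bool ({v, u} \<in> E) * y v * y u)
      = (\<Sum>i<n. \<Sum>j<n. a i j * y (i + 1) * y (j + 1))"
    unfolding sum_lessThan_shift1[symmetric] a_def ..
  also have "\<dots> \<le> \<mu> * (\<Sum>i<n. (y (i + 1))\<^sup>2)" by (rule max)
  also have "\<dots> = \<mu> * (\<Sum>v\<in>{1..n}. (y v)\<^sup>2)"
    unfolding sum_lessThan_shift1[of "\<lambda>v. (y v)\<^sup>2"] ..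
  also have "\<dots> \<le> largest_eigenvalue n E * (\<Sum>v\<in>{1..n}. (y v)\<^sup>2)"
    by (intro mult_right_mono sum_nonneg) (auto simp: \<open>\<mu> \<le> _\<close>)
  finally show "(\<Sum>v\<in>{1..n}. \<Sum>u\<in>{1..n}. of_bool ({v, u} \<in> E) * y v * y u)
           \<le> largest_eigenvalue n E * (\<Sum>v\<in>{1..n}. (y v)\<^sup>2)" .
qed

text \<open>The Collatz--Wielandt bound: compare an eigenvector with the positive supersolution \<open>w\<close>
  at a vertex maximizing the ratio of the two.\<close>

lemma largest_eigenvalue_le:
  assumes n: "n > 0" and w: "\<And>v. v \<in> {1..n} \<Longrightarrow> w v > 0"
    and super: "\<And>v. v \<in> {1..n} \<Longrightarrow> (\<Sum>u\<in>{1..n}. of_bool ({v, u} \<in> E) * w u) \<le> L * w v"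
  shows "largest_eigenvalue n E \<le> L"
proof -
  define k where "k = largest_eigenvalue n E"
  obtain x where x: "dim_vec x = n" "\<exists>i<n. vec_index x i \<noteq> 0"
    "\<And>i. i < n \<Longrightarrow> (\<Sum>j<n. (if {i + 1, j + 1} \<in> E then 1 else 0) * vec_index x j) = k * vec_index x i"
    using largest_eigenvalue_max(1)[OF n, of E]
    unfolding eigenvalue_def adjacency_eigenvector_iff k_def by auto
  define z where "z = (\<lambda>v. vec_index x (v - 1))"
  have z_eq: "(\<Sum>u\<in>{1..n}. of_bool ({v, u} \<in> E) * z u) = k * z v" if "v \<in> {1..n}" for v
  proof -
    have "(\<Sum>u\<in>{1..n}. of_bool ({v, u} \<in> E) * z u)
        = (\<Sum>j<n. (if {(v - 1) + 1, j + 1} \<in> E then 1 else 0) * vec_index x j)"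
      unfolding sum_lessThan_shift1[symmetric] using that
      by (intro sum.cong) (auto simp: z_def of_bool_def)
    also have "\<dots> = k * vec_index x (v - 1)" using that by (intro x(3)) auto
    finally show ?thesis by (simp add: z_def)
  qed
  obtain v where v: "v \<in> {1..n}" "\<And>u. u \<in> {1..n} \<Longrightarrow> \<bar>z u\<bar> / w u \<le> \<bar>z v\<bar> / w v"
  proof -
    have fin: "finite ((\<lambda>u. \<bar>z u\<bar> / w u) ` {1..n})" "(\<lambda>u. \<bar>z u\<bar> / w u) ` {1..n} \<noteq> {}"
      using n by auto
    from Max_in[OF fin] obtain v where
      "v \<in> {1..n}" "Max ((\<lambda>u. \<bar>z u\<bar> / w u) ` {1..n}) = \<bar>z v\<bar> / w v" by auto
    moreover have "\<bar>z u\<bar> / w u \<le> Max ((\<lambda>u. \<bar>z u\<bar> / w u) ` {1..n})" if "u \<in> {1..n}" for u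
      using that by (intro Max_ge fin imageI)
    ultimately show thesis by (intro that[of v]) auto
  qed
  define r where "r = \<bar>z v\<bar> / w v"
  have zr: "\<bar>z u\<bar> \<le> r * w u" if "u \<in> {1..n}" for u
    using v(2)[OF that] w[OF that] unfolding r_def by (simp add: pos_divide_le_eq)
  obtain i where i: "i < n" "vec_index x i \<noteq> 0" using x(2) by auto
  have "z (i + 1) \<noteq> 0" "i + 1 \<in> {1..n}" using i by (auto simp: z_def)
  hence "0 < r * w (i + 1)" using zr[of "i + 1"] by linarith
  hence r: "r > 0" using w[OF \<open>i + 1 \<in> {1..n}\<close>] by (simp add: zero_less_mult_iff)
  have zv: "\<bar>z v\<bar> = r * w v" using w[OF v(1)] by (simp add: r_def)
  have "k * (r * w v) \<le> \<bar>k * z v\<bar>" unfolding abs_mult zv using r w[OF v(1)]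
    by (intro mult_right_mono) auto
  also have "\<dots> = \<bar>\<Sum>u\<in>{1..n}. of_bool ({v, u} \<in> E) * z u\<bar>" using z_eq[OF v(1)] by simp
  also have "\<dots> \<le> (\<Sum>u\<in>{1..n}. \<bar>of_bool ({v, u} \<in> E) * z u\<bar>)" by (rule sum_abs)
  also have "\<dots> \<le> (\<Sum>u\<in>{1..n}. of_bool ({v, u} \<in> E) * (r * w u))"
    by (intro sum_mono) (auto simp: abs_mult intro!: zr)
  also have "\<dots> = r * (\<Sum>u\<in>{1..n}. of_bool ({v, u} \<in> E) * w u)"
    by (simp add: sum_distrib_left mult.left_commute del: sum_of_bool_mult_eq sum_mult_of_bool_eq)
  also have "\<dots> \<le> r * (L * w v)" using r super[OF v(1)] by (intro mult_left_mono) auto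
  finally have "k * (r * w v) \<le> L * (r * w v)" by (simp add: mult_ac)
  thus ?thesis using r w[OF v(1)] by (simp add: k_def)
qed

section \<open>Degrees and the largest eigenvalue of a graph\<close>

definition nbr :: "nat set set \<Rightarrow> nat \<Rightarrow> nat set" where
  "nbr E v = {u. {v, u} \<in> E}"

text \<open>Neighbours of v are left out so that the edges at v and the edges leading on to t are
  distinct, as the union bound over trees requires; the excess at neighbours is accounted for
  separately.\<close>

definition sphere2 :: "nat set set \<Rightarrow> nat \<Rightarrow> nat set" where
  "sphere2 E v = {t. t \<noteq> v \<and> t \<notin> nbr E v \<and> (\<exists>u. u \<in> nbr E v \<and> t \<in> nbr E u)}"

lemma finite_possible_edges [simp, intro]: "finite (possible_edges n)"
  by (rule finite_subset[of _ "Pow {1..n}"]) (auto simp: possible_edges_def)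

lemma pair_in_possible_edges:
  "{u, v} \<in> possible_edges n \<longleftrightarrow> u \<in> {1..n} \<and> v \<in> {1..n} \<and> u \<noteq> v"
  by (auto simp: possible_edges_def card_insert_if)

lemma nbr_commute: "u \<in> nbr E v \<longleftrightarrow> v \<in> nbr E u"
  by (simp add: nbr_def insert_commute)

context
  fixes n :: nat and E :: "nat set set"
  assumes E: "E \<subseteq> possible_edges n"
begin

lemma nbrD: "u \<in> nbr E v \<Longrightarrow> u \<in> {1..n} \<and> v \<in> {1..n} \<and> u \<noteq> v"
  using E pair_in_possible_edges[of v u n] by (auto simp: nbr_def)

lemma finite_nbr [simp, intro]: "finite (nbr E v)"
  by (rule finite_subset[of _ "{1..n}"]) (use nbrD in auto)

lemma sphere2D: "t \<in> sphere2 E v \<Longrightarrow> t \<in> {1..n}"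
  using nbrD by (auto simp: sphere2_def)

lemma finite_sphere2 [simp, intro]: "finite (sphere2 E v)"
  by (rule finite_subset[of _ "{1..n}"]) (use sphere2D in auto)

lemma card_incident_edges: "card {e \<in> E. v \<in> e} = card (nbr E v)"
proof -
  have "bij_betw (\<lambda>u. {v, u}) (nbr E v) {e \<in> E. v \<in> e}"
  proof (rule bij_betw_imageI)
    show "inj_on (\<lambda>u. {v, u}) (nbr E v)" by (auto simp: inj_on_def doubleton_eq_iff)
    show "(\<lambda>u. {v, u}) ` nbr E v = {e \<in> E. v \<in> e}"
    proof safe
      fix e assume e: "e \<in> E" "v \<in> e"
      hence "card e = 2" using E by (auto simp: possible_edges_def)
      then obtain a b where "e = {a, b}" by (auto simp: card_2_iff)
      with e have "\<exists>u. e = {v, u}" by (auto simp: insert_commute)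
      with e show "e \<in> (\<lambda>u. {v, u}) ` nbr E v" by (auto simp: nbr_def)
    qed (auto simp: nbr_def)
  qed
  thus ?thesis by (simp add: bij_betw_same_card)
qed

lemma max_degree_eq: "max_degree n E = Max ((\<lambda>v. card (nbr E v)) ` {1..n})"
  by (simp add: max_degree_def card_incident_edges)

lemma card_nbr_le_max_degree: "v \<in> {1..n} \<Longrightarrow> card (nbr E v) \<le> max_degree n E"
  unfolding max_degree_eq by (intro Max_ge) auto

lemma max_degree_attained:
  assumes "n > 0" obtains v where "v \<in> {1..n}" "card (nbr E v) = max_degree n E"
proof -
  have "Max ((\<lambda>v. card (nbr E v)) ` {1..n}) \<in> (\<lambda>v. card (nbr E v)) ` {1..n}"
    using assms by (intro Max_in) auto
  thus thesis using that unfolding max_degree_eq by auto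
qed

lemma max_degree_le: "max_degree n E \<le> n" if n: "n > 0"
proof -
  obtain v where "card (nbr E v) = max_degree n E" using max_degree_attained[OF n] by metis
  moreover have "card (nbr E v) \<le> card {1..n}" by (intro card_mono) (use nbrD in auto)
  ultimately show ?thesis by simp
qed

lemma sum_adjacent: "(\<Sum>u\<in>{1..n}. of_bool ({v, u} \<in> E) * f u) = (\<Sum>u\<in>nbr E v. f u :: real)"
proof -
  have "(\<Sum>u\<in>{1..n}. of_bool ({v, u} \<in> E) * f u) = (\<Sum>u\<in>{1..n}. if u \<in> nbr E v then f u else 0)"
    by (intro sum.cong) (auto simp: nbr_def)
  also have "\<dots> = (\<Sum>u\<in>{1..n} \<inter> nbr E v. f u)" by (rule sum.inter_restrict[symmetric]) simp
  also have "{1..n} \<inter> nbr E v = nbr E v" using nbrD by auto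
  finally show ?thesis .
qed

lemma sum_card_nbr: "(\<Sum>v\<in>{1..n}. card (nbr E v)) = 2 * card E"
proof -
  have finE: "finite E" using E finite_subset by blast
  have "(\<Sum>v\<in>{1..n}. card (nbr E v)) = (\<Sum>v\<in>{1..n}. \<Sum>e\<in>E. of_bool (v \<in> e))"
    using finE by (intro sum.cong) (simp_all add: card_incident_edges[symmetric] Int_def)
  also have "\<dots> = (\<Sum>e\<in>E. \<Sum>v\<in>{1..n}. of_bool (v \<in> e))" by (rule sum.swap)
  also have "\<dots> = (\<Sum>e\<in>E. 2)"
  proof (intro sum.cong refl)
    fix e assume "e \<in> E"
    hence e: "e \<subseteq> {1..n}" "card e = 2" using E by (auto simp: possible_edges_def)
    have "{1..n} \<inter> e = e" using e by blast
    thus "(\<Sum>v\<in>{1..n}. of_bool (v \<in> e)) = (2 :: nat)" using e by (simp add: Int_def)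
  qed
  finally show ?thesis by simp
qed

section \<open>Deterministic bounds on the largest eigenvalue\<close>

lemma largest_eigenvalue_le_max_degree:
  assumes n: "n > 0" shows "largest_eigenvalue n E \<le> max_degree n E"
proof (rule largest_eigenvalue_le[OF n, of "\<lambda>_. 1"])
  fix v assume "v \<in> {1..n}"
  thus "(\<Sum>u\<in>{1..n}. of_bool ({v, u} \<in> E) * 1) \<le> real (max_degree n E) * 1"
    unfolding sum_adjacent using card_nbr_le_max_degree[of v] by simp
qed simp

lemma average_degree_le_largest_eigenvalue:
  assumes n: "n > 0" shows "2 * card E / n \<le> largest_eigenvalue n E"
proof -
  have "real (2 * card E) = (\<Sum>v\<in>{1..n}. \<Sum>u\<in>{1..n}. of_bool ({v, u} \<in> E) * 1 * 1)"
    unfolding mult_1_right sum_card_nbr[symmetric]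
    using sum_adjacent[of _ "\<lambda>_. 1"] by simp
  also have "\<dots> \<le> largest_eigenvalue n E * (\<Sum>v\<in>{1..n}. 1\<^sup>2)"
    by (rule largest_eigenvalue_max(2)[OF n])
  finally show ?thesis using n by (simp add: field_simps)
qed

text \<open>The test vector is the top eigenvector of the star around a vertex of maximum degree:
  sqrt \<Delta> at the centre and 1 at the leaves. Its entries are nonnegative, so further edges
  only increase the quadratic form.\<close>

lemma sqrt_max_degree_le_largest_eigenvalue:
  assumes n: "n > 0" shows "sqrt (max_degree n E) \<le> largest_eigenvalue n E"
proof -
  obtain v where v: "v \<in> {1..n}" "card (nbr E v) = max_degree n E"
    using max_degree_attained[OF n] .
  define D where "D = real (max_degree n E)"
  define s where "s = sqrt D"
  have D: "D \<ge> 0" "s \<ge> 0" "s * s = D" by (simp_all add: D_def s_def)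
  show ?thesis
  proof (cases "D = 0")
    \<comment> \<open>The star vector would be 0 here, so the nonnegative average degree serves
      instead.\<close>
    case True
    thus ?thesis using average_degree_le_largest_eigenvalue[OF n]
      by (simp add: D_def) (meson divide_nonneg_nonneg mult_nonneg_nonneg of_nat_0_le_iff order_trans zero_le_numeral)
  next
    case False
    define y where "y = (\<lambda>u. if u = v then s else of_bool (u \<in> nbr E v))"
    have y0: "y u \<ge> 0" for u using D by (simp add: y_def)
    have vn: "v \<notin> nbr E v" using nbrD by blast
    have y1: "y u = 1" if "u \<in> nbr E v" for u using that vn by (auto simp: y_def)
    have sub: "insert v (nbr E v) \<subseteq> {1..n}" using v nbrD by auto
    have cardD: "real (card (nbr E v)) = D" by (simp add: v D_def)
    have "(\<Sum>u\<in>{1..n}. (y u)\<^sup>2) = (\<Sum>u\<in>insert v (nbr E v). (y u)\<^sup>2)"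
      using sub by (intro sum.mono_neutral_right) (auto simp: y_def)
    also have "\<dots> = s\<^sup>2 + (\<Sum>u\<in>nbr E v. 1)" using vn y1 by (simp add: y_def)
    also have "\<dots> = 2 * D" using cardD D by (simp add: power2_eq_square)
    finally have norm: "(\<Sum>u\<in>{1..n}. (y u)\<^sup>2) = 2 * D" .
    \<comment> \<open>Row \<open>v\<close> contributes one half of the form of the star, and the
      rows of its leaves contribute the other half, each at least \<open>s\<close>.\<close>
    have "2 * s * D = s * D + (\<Sum>u\<in>nbr E v. s)" using cardD by simp
    also have "\<dots> \<le> s * D + (\<Sum>u\<in>nbr E v. \<Sum>t\<in>nbr E u. y u * y t)"
    proof (intro add_left_mono sum_mono)
      fix u assume u: "u \<in> nbr E v"
      hence "v \<in> nbr E u" by (simp add: nbr_commute)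
      hence "y u * y v \<le> (\<Sum>t\<in>nbr E u. y u * y t)"
        by (intro member_le_sum) (auto simp: y0)
      thus "s \<le> (\<Sum>t\<in>nbr E u. y u * y t)" using y1[OF u] by (simp add: y_def)
    qed
    also have "s * D = (\<Sum>t\<in>nbr E v. y v * y t)" using y1 cardD by (simp add: y_def)
    also have "(\<Sum>t\<in>nbr E v. y v * y t) + (\<Sum>u\<in>nbr E v. \<Sum>t\<in>nbr E u. y u * y t)
        = (\<Sum>u\<in>insert v (nbr E v). \<Sum>t\<in>nbr E u. y u * y t)" using vn by simp
    also have "\<dots> \<le> (\<Sum>u\<in>{1..n}. \<Sum>t\<in>nbr E u. y u * y t)"
      using sub by (intro sum_mono2 sum_nonneg) (auto simp: y0)
    also have "\<dots> = (\<Sum>u\<in>{1..n}. \<Sum>t\<in>{1..n}. of_bool ({u, t} \<in> E) * y u * y t)"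
      unfolding sum_adjacent[symmetric] by (simp only: mult.assoc)
    also have "\<dots> \<le> largest_eigenvalue n E * (\<Sum>u\<in>{1..n}. (y u)\<^sup>2)"
      by (rule largest_eigenvalue_max(2)[OF n])
    finally have "2 * s * D \<le> largest_eigenvalue n E * (2 * D)" unfolding norm .
    thus ?thesis using D False by (simp add: s_def D_def)
  qed
qed

text \<open>The supersolution for the Collatz--Wielandt bound puts weight \<open>g\<close>, proportional to the
  excess of the degree over \<open>(1 + \<eta> / 2) x\<close>, on each vertex and \<open>g / x\<close> on its neighbours.
  The constant 1 takes care of all vertices without excess in their second neighbourhood.\<close>

lemma largest_eigenvalue_le_of_small_excess:
  fixes \<eta> x :: real
  assumes n: "n > 0" and \<eta>: "0 < \<eta>" and x: "2 / \<eta> \<le> x"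
    and deg: "real (max_degree n E) \<le> x\<^sup>2"
    and codeg: "\<And>v t. v \<in> {1..n} \<Longrightarrow> t \<in> {1..n} \<Longrightarrow> v \<noteq> t \<Longrightarrow> card (nbr E v \<inter> nbr E t) \<le> 2"
    and excess: "\<And>v. v \<in> {1..n} \<Longrightarrow>
      (\<Sum>t\<in>sphere2 E v. max 0 (card (nbr E t) - (1 + \<eta> / 2) * x)) \<le> \<eta>\<^sup>2 * x ^ 3 / 4"
  shows "largest_eigenvalue n E \<le> (1 + \<eta>) * x"
proof -
  have x0: "x > 0" using \<eta> x by (meson divide_pos_pos less_le_trans zero_less_numeral)
  define d where "d = (\<lambda>v. real (card (nbr E v)))"
  define e where "e = (\<lambda>v. max 0 (d v - (1 + \<eta> / 2) * x))"
  define g where "g = (\<lambda>v. e v / (\<eta> * x))"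
  define h where "h = (\<lambda>v. \<Sum>u\<in>nbr E v. g u)"
  have g0: "g v \<ge> 0" for v using \<eta> x0 by (simp add: g_def e_def)
  have h0: "h v \<ge> 0" for v by (simp add: h_def sum_nonneg g0)
  show ?thesis
  proof (rule largest_eigenvalue_le[OF n, of "\<lambda>v. 1 + g v + h v / x"])
    fix v assume "v \<in> {1..n}"
    show "0 < 1 + g v + h v / x" using g0[of v] h0[of v] x0
      by (intro add_pos_nonneg divide_nonneg_pos) auto
  next
    fix v assume v: "v \<in> {1..n}"
    have dx: "d v \<le> x * x"
      using card_nbr_le_max_degree[OF v] deg by (simp add: d_def power2_eq_square)
    \<comment> \<open>Walks of length two from v are sorted by their endpoint t: t = v is reached
      \<open>d v\<close> times, and any other endpoint at most twice by \<open>codeg\<close>, lying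
      then in \<open>nbr E v\<close> or \<open>sphere2 E v\<close>.\<close>
    have "(\<Sum>u\<in>nbr E v. h u) = (\<Sum>u\<in>nbr E v. \<Sum>t\<in>{1..n}. of_bool ({u, t} \<in> E) * g t)"
      unfolding h_def sum_adjacent ..
    also have "\<dots> = (\<Sum>t\<in>{1..n}. \<Sum>u\<in>nbr E v. of_bool ({u, t} \<in> E) * g t)" by (rule sum.swap)
    also have "\<dots> = (\<Sum>t\<in>{1..n}. card (nbr E v \<inter> nbr E t) * g t)"
    proof (intro sum.cong refl)
      fix t
      have "(\<Sum>u\<in>nbr E v. of_bool ({u, t} \<in> E) * g t)
          = (\<Sum>u\<in>nbr E v. if u \<in> nbr E t then g t else 0)"
        by (intro sum.cong) (auto simp: nbr_def insert_commute)
      also have "\<dots> = (\<Sum>u\<in>nbr E v \<inter> nbr E t. g t)" by (rule sum.inter_restrict[symmetric]) simp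
      finally show "(\<Sum>u\<in>nbr E v. of_bool ({u, t} \<in> E) * g t) = card (nbr E v \<inter> nbr E t) * g t"
        by simp
    qed
    also have "\<dots> \<le> (\<Sum>t\<in>{1..n}. (if t = v then d v * g v else 0)
        + ((if t \<in> nbr E v then 2 * g t else 0) + (if t \<in> sphere2 E v then 2 * g t else 0)))"
    proof (rule sum_mono)
      fix t assume t: "t \<in> {1..n}"
      show "card (nbr E v \<inter> nbr E t) * g t \<le> (if t = v then d v * g v else 0)
        + ((if t \<in> nbr E v then 2 * g t else 0) + (if t \<in> sphere2 E v then 2 * g t else 0))"
      proof (cases "t = v")
        case True
        thus ?thesis using g0[of t] by (simp add: d_def)
      next
        case False
        have c: "card (nbr E v \<inter> nbr E t) * g t \<le> 2 * g t"
          using codeg[OF v t] False g0[of t] by (intro mult_right_mono) auto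
        show ?thesis
        proof (cases "t \<in> nbr E v \<or> t \<in> sphere2 E v")
          case True
          thus ?thesis using c g0[of t] False by auto
        next
          case no: False
          hence "nbr E v \<inter> nbr E t = {}" using False by (auto simp: sphere2_def nbr_commute)
          thus ?thesis using no False by simp
        qed
      qed
    qed
    also have "\<dots> = d v * g v + (2 * h v + 2 * (\<Sum>t\<in>sphere2 E v. g t))"
    proof -
      have "(\<Sum>t\<in>{1..n}. if t \<in> A then 2 * g t else 0) = 2 * (\<Sum>t\<in>A. g t)" if "A \<subseteq> {1..n}" for A
        using that by (simp add: sum.inter_restrict[symmetric] Int_absorb1 sum_distrib_left)
      moreover have "nbr E v \<subseteq> {1..n}" "sphere2 E v \<subseteq> {1..n}" using nbrD sphere2D by auto
      ultimately show ?thesis using v by (simp add: sum.distrib h_def)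
    qed
    finally have paths: "(\<Sum>u\<in>nbr E v. h u) \<le> d v * g v + 2 * h v + 2 * (\<Sum>t\<in>sphere2 E v. g t)"
      by simp
    \<comment> \<open>The factor 1/4 in \<open>excess\<close> is set so that the doubled far weight,
      once divided by x, costs \<eta> x / 2: exactly the slack that the degree threshold (1 + \<eta>
      / 2) x leaves.\<close>
    have "(\<Sum>t\<in>sphere2 E v. g t) = (\<Sum>t\<in>sphere2 E v. e t) / (\<eta> * x)"
      by (simp add: g_def sum_divide_distrib)
    also have "\<dots> \<le> (\<eta>\<^sup>2 * x ^ 3 / 4) / (\<eta> * x)"
      using excess[OF v] \<eta> x0 by (intro divide_right_mono) (auto simp: e_def d_def)
    also have "\<dots> = \<eta> * x * x / 4" using \<eta> x0 by (simp add: power2_eq_square power3_eq_cube)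
    finally have far: "2 * (\<Sum>t\<in>sphere2 E v. g t) \<le> \<eta> * x * x / 2" by simp
    \<comment> \<open>This is where x must be large: the excess at the neighbours, counted twice, is
      absorbed by the slack in the \<open>h v\<close> term.\<close>
    have "2 \<le> x * \<eta>" using x \<eta> by (simp add: field_simps)
    hence near: "2 * h v \<le> x * \<eta> * h v" by (intro mult_right_mono h0)
    have "d v * g v \<le> x * x * g v" using dx by (intro mult_right_mono g0)
    with paths near far have "(\<Sum>u\<in>nbr E v. h u) \<le> x * x * g v + x * \<eta> * h v + \<eta> * x * x / 2"
      by linarith
    hence "(\<Sum>u\<in>nbr E v. h u) / x \<le> (x * x * g v + x * \<eta> * h v + \<eta> * x * x / 2) / x"
      using x0 by (intro divide_right_mono) auto
    also have "\<dots> = x * g v + \<eta> * h v + \<eta> * x / 2" using x0 by (simp add: field_simps)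
    finally have sum_h: "(\<Sum>u\<in>nbr E v. h u) / x \<le> x * g v + \<eta> * h v + \<eta> * x / 2" .
    \<comment> \<open>The normalization of \<open>g\<close> turns the excess degree of v into the
      slack of the \<open>g v\<close> term.\<close>
    have "\<eta> * x * g v = e v" using \<eta> x0 by (simp add: g_def)
    hence d: "d v \<le> (1 + \<eta> / 2) * x + \<eta> * x * g v" by (simp add: e_def)
    \<comment> \<open>The budget is exact: the constant, \<open>g v\<close> and \<open>h v\<close>
      terms add up to (1 + \<eta>) x, (1 + \<eta>) x g v and (1 + \<eta>) h v.\<close>
    have "(\<Sum>u\<in>{1..n}. of_bool ({v, u} \<in> E) * (1 + g u + h u / x))
        = d v + h v + (\<Sum>u\<in>nbr E v. h u) / x"
      unfolding sum_adjacent by (simp add: sum.distrib h_def d_def sum_divide_distrib)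
    also have "\<dots> \<le> (1 + \<eta> / 2) * x + \<eta> * x * g v + h v + (x * g v + \<eta> * h v + \<eta> * x / 2)"
      using d sum_h by linarith
    also have "\<dots> = (1 + \<eta>) * x * (1 + g v + h v / x)" using x0 by (simp add: field_simps)
    finally show "(\<Sum>u\<in>{1..n}. of_bool ({v, u} \<in> E) * (1 + g u + h u / x))
        \<le> (1 + \<eta>) * x * (1 + g v + h v / x)" .
  qed
qed

end

section \<open>Exponential moments in the binomial random graph\<close>

lemma set_pmf_gnp_subset: "G \<in> set_pmf (gnp n p) \<Longrightarrow> G \<subseteq> possible_edges n"
  by (auto simp: gnp_def)

lemma integrable_gnp [simp, intro]:
  fixes f :: "nat set set \<Rightarrow> real"
  shows "integrable (measure_pmf (gnp n p)) f"
proof (rule integrable_measure_pmf_finite)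
  have "set_pmf (gnp n p) \<subseteq> Pow (possible_edges n)" using set_pmf_gnp_subset by blast
  thus "finite (set_pmf (gnp n p))" by (rule finite_subset) simp
qed

lemma gnp_prob_mono:
  assumes "\<And>G. G \<subseteq> possible_edges n \<Longrightarrow> G \<in> A \<Longrightarrow> G \<in> B"
  shows "measure_pmf.prob (gnp n p) A \<le> measure_pmf.prob (gnp n p) B"
proof -
  have "measure_pmf.prob (gnp n p) A = measure_pmf.prob (gnp n p) (A \<inter> set_pmf (gnp n p))"
    by (simp add: measure_Int_set_pmf)
  also have "\<dots> \<le> measure_pmf.prob (gnp n p) B"
    by (rule measure_pmf.finite_measure_mono) (use assms set_pmf_gnp_subset in auto)
  finally show ?thesis .
qed

lemma gnp_expectation_mono:
  fixes f g :: "nat set set \<Rightarrow> real"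
  assumes "\<And>G. G \<subseteq> possible_edges n \<Longrightarrow> f G \<le> g G"
  shows "measure_pmf.expectation (gnp n p) f \<le> measure_pmf.expectation (gnp n p) g"
  by (rule integral_mono_AE) (use assms set_pmf_gnp_subset in \<open>auto simp: AE_measure_pmf_iff\<close>)

lemma gnp_prob_UN_le:
  fixes b :: real
  assumes "finite I" "\<And>i. i \<in> I \<Longrightarrow> measure_pmf.prob (gnp n p) (A i) \<le> b"
  shows "measure_pmf.prob (gnp n p) (\<Union>i\<in>I. A i) \<le> card I * b"
proof -
  have "measure_pmf.prob (gnp n p) (\<Union>i\<in>I. A i) \<le> (\<Sum>i\<in>I. measure_pmf.prob (gnp n p) (A i))"
    by (rule measure_pmf.finite_measure_subadditive_finite) (use assms in auto)
  also have "\<dots> \<le> (\<Sum>i\<in>I. b)" by (intro sum_mono assms)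
  finally show ?thesis by simp
qed

lemma gnp_prob_le_expectation:
  fixes f :: "nat set set \<Rightarrow> real"
  assumes "\<And>G. G \<subseteq> possible_edges n \<Longrightarrow> of_bool (G \<in> A) \<le> f G"
  shows "measure_pmf.prob (gnp n p) A \<le> measure_pmf.expectation (gnp n p) f"
proof -
  have "measure_pmf.prob (gnp n p) A = measure_pmf.expectation (gnp n p) (indicator A)" by simp
  also have "\<dots> \<le> measure_pmf.expectation (gnp n p) f"
    by (rule gnp_expectation_mono) (use assms in \<open>auto simp: indicator_def of_bool_def\<close>)
  finally show ?thesis .
qed

context
  fixes n :: nat and p :: real
  assumes p: "0 \<le> p" "p \<le> 1"
begin

lemma gnp_expectation_prod:
  fixes \<phi> :: "nat set \<Rightarrow> bool \<Rightarrow> real"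
  assumes "\<And>e b. \<phi> e b \<ge> 0"
  shows "measure_pmf.expectation (gnp n p) (\<lambda>G. \<Prod>e\<in>possible_edges n. \<phi> e (e \<in> G))
       = (\<Prod>e\<in>possible_edges n. p * \<phi> e True + (1 - p) * \<phi> e False)"
proof -
  have "measure_pmf.expectation (gnp n p) (\<lambda>G. \<Prod>e\<in>possible_edges n. \<phi> e (e \<in> G))
      = measure_pmf.expectation (Pi_pmf (possible_edges n) False (\<lambda>_. bernoulli_pmf p))
          (\<lambda>f. \<Prod>e\<in>possible_edges n. \<phi> e (f e))"
    unfolding gnp_def integral_map_pmf by (intro Bochner_Integration.integral_cong prod.cong) auto
  also have "\<dots> = (\<Prod>e\<in>possible_edges n. measure_pmf.expectation (bernoulli_pmf p) (\<phi> e))"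
    by (rule expectation_prod_Pi_pmf) (auto intro: assms integrable_measure_pmf_finite)
  also have "\<dots> = (\<Prod>e\<in>possible_edges n. p * \<phi> e True + (1 - p) * \<phi> e False)"
    using p by (simp add: mult.commute)
  finally show ?thesis .
qed

lemma sum_degrees_eq:
  assumes G: "G \<subseteq> possible_edges n" and S: "finite S"
  shows "(\<Sum>t\<in>S. card (nbr G t)) = (\<Sum>e\<in>possible_edges n. card (e \<inter> S) * of_bool (e \<in> G))"
proof -
  have "(\<Sum>t\<in>S. card (nbr G t)) = (\<Sum>t\<in>S. \<Sum>e\<in>possible_edges n. of_bool (e \<in> G \<and> t \<in> e))"
  proof (intro sum.cong refl)
    fix t
    have "possible_edges n \<inter> {e. e \<in> G \<and> t \<in> e} = {e \<in> G. t \<in> e}" using G by auto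
    thus "card (nbr G t) = (\<Sum>e\<in>possible_edges n. of_bool (e \<in> G \<and> t \<in> e))"
      by (simp add: card_incident_edges[OF G, symmetric])
  qed
  also have "\<dots> = (\<Sum>e\<in>possible_edges n. \<Sum>t\<in>S. of_bool (e \<in> G \<and> t \<in> e))" by (rule sum.swap)
  also have "\<dots> = (\<Sum>e\<in>possible_edges n. card (e \<inter> S) * of_bool (e \<in> G))"
  proof (intro sum.cong refl)
    fix e
    have "S \<inter> {t. t \<in> e} = e \<inter> S" by auto
    thus "(\<Sum>t\<in>S. of_bool (e \<in> G \<and> t \<in> e)) = card (e \<inter> S) * of_bool (e \<in> G)"
      using S by simp
  qed
  finally show ?thesis .
qed

lemma sum_card_edge_Int_le:
  assumes "S \<subseteq> {1..n}"
  shows "(\<Sum>e\<in>possible_edges n. card (e \<inter> S)) \<le> n * card S"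
proof -
  have fin: "finite S" using assms finite_subset by blast
  have "(\<Sum>e\<in>possible_edges n. card (e \<inter> S)) = (\<Sum>t\<in>S. card (nbr (possible_edges n) t))"
    by (subst sum_degrees_eq[OF order_refl fin]) simp
  also have "\<dots> \<le> (\<Sum>t\<in>S. card {1..n})"
    by (intro sum_mono card_mono) (auto dest: nbrD[OF order_refl])
  finally show ?thesis by (simp add: mult.commute)
qed

text \<open>An edge meets \<open>S\<close> in at most two vertices, so convexity of the exponential bounds the
  moment generating function of each summand by \<open>exp (p \<kappa> \<bar>e \<inter> S\<bar>)\<close>.\<close>

lemma gnp_degree_mgf:
  fixes \<theta> :: real
  assumes \<theta>: "\<theta> \<ge> 0" and S: "S \<subseteq> {1..n}" and F: "F \<subseteq> possible_edges n"
  shows "measure_pmf.expectation (gnp n p)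
           (\<lambda>G. of_bool (F \<subseteq> G) * exp (\<theta> * (\<Sum>t\<in>S. card (nbr G t))))
         \<le> p ^ card F * exp (\<theta> * (\<Sum>e\<in>F. card (e \<inter> S))) *
           exp (p * ((exp (2 * \<theta>) - 1) / 2) * (n * card S))"
proof -
  define \<kappa> where "\<kappa> = (exp (2 * \<theta>) - 1) / 2"
  have \<kappa>_eq: "exp (2 * \<theta>) = 1 + 2 * \<kappa>" by (simp add: \<kappa>_def field_simps)
  have \<kappa>: "\<kappa> \<ge> 0" using \<theta> by (simp add: \<kappa>_def)
  have finS: "finite S" and finF: "finite F"
    using S F finite_subset[OF _ finite_possible_edges] finite_subset by blast+
  define \<phi> where "\<phi> = (\<lambda>e b. (if e \<in> F then of_bool b else 1) * exp (\<theta> * card (e \<inter> S) * of_bool b) :: real)"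
  have "measure_pmf.expectation (gnp n p) (\<lambda>G. of_bool (F \<subseteq> G) * exp (\<theta> * (\<Sum>t\<in>S. card (nbr G t))))
      \<le> measure_pmf.expectation (gnp n p) (\<lambda>G. \<Prod>e\<in>possible_edges n. \<phi> e (e \<in> G))"
  proof (rule gnp_expectation_mono)
    fix G assume G: "G \<subseteq> possible_edges n"
    have "(\<Prod>e\<in>possible_edges n. if e \<in> F then of_bool (e \<in> G) else 1)
        = (\<Prod>e\<in>possible_edges n \<inter> F. of_bool (e \<in> G) :: real)"
      by (rule prod.inter_restrict[symmetric]) simp
    also have "possible_edges n \<inter> F = F" using F by blast
    also have "(\<Prod>e\<in>F. of_bool (e \<in> G) :: real) = of_bool (F \<subseteq> G)"
      using finF by (auto simp: subset_iff)
    finally have 1: "(\<Prod>e\<in>possible_edges n. if e \<in> F then of_bool (e \<in> G) else 1)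
      = (of_bool (F \<subseteq> G) :: real)" .
    have "(\<Prod>e\<in>possible_edges n. exp (\<theta> * card (e \<inter> S) * of_bool (e \<in> G)))
        = exp (\<theta> * real (\<Sum>e\<in>possible_edges n. card (e \<inter> S) * of_bool (e \<in> G)))"
      unfolding exp_sum[OF finite_possible_edges, symmetric] of_nat_sum sum_distrib_left
      by (intro arg_cong[where f = exp] sum.cong) (auto simp: of_bool_def)
    also have "\<dots> = exp (\<theta> * (\<Sum>t\<in>S. card (nbr G t)))"
      unfolding sum_degrees_eq[OF G finS] ..
    finally show "of_bool (F \<subseteq> G) * exp (\<theta> * (\<Sum>t\<in>S. card (nbr G t)))
        \<le> (\<Prod>e\<in>possible_edges n. \<phi> e (e \<in> G))"
      by (simp add: \<phi>_def prod.distrib 1)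
  qed
  also have "\<dots> = (\<Prod>e\<in>possible_edges n. p * \<phi> e True + (1 - p) * \<phi> e False)"
    by (rule gnp_expectation_prod) (simp add: \<phi>_def)
  also have "\<dots> \<le> (\<Prod>e\<in>possible_edges n.
      (if e \<in> F then p * exp (\<theta> * card (e \<inter> S)) else 1) * exp (p * \<kappa> * card (e \<inter> S)))"
  proof (intro prod_mono conjI)
    fix e assume e: "e \<in> possible_edges n"
    show "0 \<le> p * \<phi> e True + (1 - p) * \<phi> e False" using p by (simp add: \<phi>_def)
    show "p * \<phi> e True + (1 - p) * \<phi> e False
        \<le> (if e \<in> F then p * exp (\<theta> * card (e \<inter> S)) else 1) * exp (p * \<kappa> * card (e \<inter> S))"
    proof (cases "e \<in> F")
      case True
      have "1 \<le> exp (p * \<kappa> * card (e \<inter> S))" using p \<kappa> by simp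
      hence "p * exp (\<theta> * card (e \<inter> S)) * 1
          \<le> p * exp (\<theta> * card (e \<inter> S)) * exp (p * \<kappa> * card (e \<inter> S))"
        using p by (intro mult_left_mono) auto
      thus ?thesis using True by (simp add: \<phi>_def)
    next
      case False
      have "card (e \<inter> S) \<le> card e"
        using e by (intro card_mono card_ge_0_finite) (auto simp: possible_edges_def)
      hence "card (e \<inter> S) \<le> 2" using e by (simp add: possible_edges_def)
      hence "card (e \<inter> S) = 0 \<or> card (e \<inter> S) = 1 \<or> card (e \<inter> S) = 2" by linarith
      moreover have "exp \<theta> \<le> 1 + \<kappa>"
      proof -
        have "0 \<le> (exp \<theta> - 1)\<^sup>2" by simp
        hence "2 * exp \<theta> \<le> 1 + exp (2 * \<theta>)"
          by (simp add: power2_eq_square algebra_simps mult_exp_exp)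
        thus ?thesis unfolding \<kappa>_eq by linarith
      qed
      moreover have "exp (\<theta> * 2) = 1 + 2 * \<kappa>" using \<kappa>_eq by (simp only: mult.commute)
      ultimately have "exp (\<theta> * card (e \<inter> S)) \<le> 1 + \<kappa> * card (e \<inter> S)" by auto
      hence "p * exp (\<theta> * card (e \<inter> S)) \<le> p * (1 + \<kappa> * card (e \<inter> S))"
        using p by (intro mult_left_mono)
      hence "p * exp (\<theta> * card (e \<inter> S)) + (1 - p) \<le> 1 + p * \<kappa> * card (e \<inter> S)"
        by (simp add: algebra_simps)
      also have "\<dots> \<le> exp (p * \<kappa> * card (e \<inter> S))" by (rule exp_ge_add_one_self)
      finally show ?thesis using False by (simp add: \<phi>_def)
    qed
  qed
  also have "\<dots> = (\<Prod>e\<in>possible_edges n \<inter> F. p * exp (\<theta> * card (e \<inter> S)))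
      * exp (p * \<kappa> * real (\<Sum>e\<in>possible_edges n. card (e \<inter> S)))"
    unfolding prod.inter_restrict[OF finite_possible_edges] of_nat_sum sum_distrib_left
      exp_sum[OF finite_possible_edges] by (rule prod.distrib)
  also have "possible_edges n \<inter> F = F" using F by blast
  also have "(\<Prod>e\<in>F. p * exp (\<theta> * card (e \<inter> S))) = p ^ card F * exp (\<theta> * (\<Sum>e\<in>F. card (e \<inter> S)))"
    using finF by (simp add: prod.distrib exp_sum[symmetric] sum_distrib_left)
  also have "p ^ card F * exp (\<theta> * (\<Sum>e\<in>F. card (e \<inter> S)))
        * exp (p * \<kappa> * real (\<Sum>e\<in>possible_edges n. card (e \<inter> S)))
      \<le> p ^ card F * exp (\<theta> * (\<Sum>e\<in>F. card (e \<inter> S))) * exp (p * \<kappa> * (n * card S))"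
    by (intro mult_left_mono iffD2[OF exp_le_cancel_iff] iffD2[OF of_nat_le_iff]
        sum_card_edge_Int_le[OF S]) (use p \<kappa> in auto)
  finally show ?thesis unfolding \<kappa>_def .
qed

lemma gnp_prob_superset: 
  assumes "F \<subseteq> possible_edges n"
  shows "measure_pmf.prob (gnp n p) {G. F \<subseteq> G} \<le> p ^ card F"
proof -
  have "measure_pmf.prob (gnp n p) {G. F \<subseteq> G} \<le> measure_pmf.expectation (gnp n p)
      (\<lambda>G. of_bool (F \<subseteq> G) * exp ((0 :: real) * (\<Sum>t\<in>{}. card (nbr G t))))"
    by (rule gnp_prob_le_expectation) auto
  also have "\<dots> \<le> p ^ card F" using gnp_degree_mgf[of 0 "{}", OF _ _ assms] by simp
  finally show ?thesis .
qed

text \<open>Chernoff bound from \<open>gnp_degree_mgf\<close> with a single vertex and no forced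
  edges. The constant (exp (2 \<theta>) - 1) / 2 inherited from there exceeds exp \<theta> - 1 only
  to second order in \<theta>, which is harmless for small tilts.\<close>

lemma gnp_degree_upper_tail:
  fixes \<theta> c :: real
  assumes "\<theta> \<ge> 0" "v \<in> {1..n}"
  shows "measure_pmf.prob (gnp n p) {G. c \<le> card (nbr G v)}
    \<le> exp (n * p * ((exp (2 * \<theta>) - 1) / 2) - \<theta> * c)"
proof -
  have "measure_pmf.prob (gnp n p) {G. c \<le> card (nbr G v)} \<le> measure_pmf.expectation (gnp n p)
      (\<lambda>G. exp (- \<theta> * c) * (of_bool ({} \<subseteq> G) * exp (\<theta> * (\<Sum>t\<in>{v}. card (nbr G t)))))"
  proof (rule gnp_prob_le_expectation)
    fix G :: "nat set set"
    have "1 \<le> exp (\<theta> * (card (nbr G v) - c))" if "c \<le> card (nbr G v)"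
      using that assms by simp
    thus "of_bool (G \<in> {G. c \<le> card (nbr G v)})
      \<le> exp (- \<theta> * c) * (of_bool ({} \<subseteq> G) * exp (\<theta> * (\<Sum>t\<in>{v}. card (nbr G t))))"
      by (auto simp: mult_exp_exp algebra_simps)
  qed
  also have "\<dots> \<le> exp (- \<theta> * c) * exp (p * ((exp (2 * \<theta>) - 1) / 2) * (n * 1))"
    unfolding integral_mult_right_zero
    using gnp_degree_mgf[of \<theta> "{v}" "{}"] assms by (intro mult_left_mono) auto
  also have "\<dots> = exp (n * p * ((exp (2 * \<theta>) - 1) / 2) - \<theta> * c)"
    by (simp add: mult_exp_exp algebra_simps)
  finally show ?thesis .
qed

text \<open>Three common neighbours of two vertices span a complete bipartite graph with 5 vertices
  and 6 edges, so the first moment is at most n^5 p^6 = (n p)^6 / n, small for polylogarithmic n p.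
  The same count for two common neighbours would give (n p)^4, hence the bound 2 on
  codegrees.\<close>

lemma gnp_codegree_tail:
  "measure_pmf.prob (gnp n p)
     {G. \<exists>v\<in>{1..n}. \<exists>t\<in>{1..n}. v \<noteq> t \<and> \<not> card (nbr G v \<inter> nbr G t) \<le> 2} \<le> n ^ 5 * p ^ 6"
proof -
  define T where "T = {U. U \<subseteq> {1..n} \<and> card U = 3}"
  define I where "I = {(v, t, U). v \<in> {1..n} \<and> t \<in> {1..n} \<and> U \<in> T \<and> v \<noteq> t \<and> v \<notin> U \<and> t \<notin> U}"
  define F where "F = (\<lambda>(v, t, U). (\<lambda>u. {v, u}) ` U \<union> (\<lambda>u. {t, u :: nat}) ` U)"
  have finT: "finite T" by (rule finite_subset[of _ "Pow {1..n}"]) (auto simp: T_def)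
  have "card T = n choose 3" unfolding T_def by (subst n_subsets) auto
  also have "\<dots> \<le> n ^ 3" by (cases "3 \<le> n") (simp_all add: binomial_le_pow binomial_eq_0)
  finally have cardT: "card T \<le> n ^ 3" .
  have I_sub: "I \<subseteq> {1..n} \<times> {1..n} \<times> T" by (auto simp: I_def)
  have finI: "finite I" by (rule finite_subset[OF I_sub]) (use finT in auto)
  have "card I \<le> card ({1..n} \<times> {1..n} \<times> T)" by (intro card_mono I_sub) (use finT in auto)
  also have "\<dots> \<le> n * (n * n ^ 3)" using cardT by (simp add: card_cartesian_product)
  also have "\<dots> = n ^ 5" by (simp add: eval_nat_numeral)
  finally have cardI: "card I \<le> n ^ 5" .
  have "measure_pmf.prob (gnp n p)
      {G. \<exists>v\<in>{1..n}. \<exists>t\<in>{1..n}. v \<noteq> t \<and> \<not> card (nbr G v \<inter> nbr G t) \<le> 2}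
    \<le> measure_pmf.prob (gnp n p) (\<Union>i\<in>I. {G. F i \<subseteq> G})"
  proof (rule gnp_prob_mono)
    fix G assume G: "G \<subseteq> possible_edges n" and
      "G \<in> {G. \<exists>v\<in>{1..n}. \<exists>t\<in>{1..n}. v \<noteq> t \<and> \<not> card (nbr G v \<inter> nbr G t) \<le> 2}"
    then obtain v t where "v \<in> {1..n}" "t \<in> {1..n}" "v \<noteq> t" "\<not> card (nbr G v \<inter> nbr G t) \<le> 2"
      by blast
    hence vt: "v \<in> {1..n}" "t \<in> {1..n}" "v \<noteq> t" "3 \<le> card (nbr G v \<inter> nbr G t)"
      by auto
    obtain U where U: "U \<subseteq> nbr G v \<inter> nbr G t" "card U = 3"
      by (rule obtain_subset_with_card_n[OF vt(4)])
    have "U \<subseteq> {1..n}" "v \<notin> U" "t \<notin> U" using U nbrD[OF G] by blast+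
    hence "(v, t, U) \<in> I" using vt U by (auto simp: I_def T_def)
    moreover have "F (v, t, U) \<subseteq> G" using U by (auto simp: F_def nbr_def)
    ultimately show "G \<in> (\<Union>i\<in>I. {G. F i \<subseteq> G})" by blast
  qed
  also have "\<dots> \<le> card I * p ^ 6"
  proof (rule gnp_prob_UN_le[OF finI])
    fix i assume "i \<in> I"
    then obtain v t U where i: "i = (v, t, U)" "v \<in> {1..n}" "t \<in> {1..n}" "U \<subseteq> {1..n}" "card U = 3"
      "v \<noteq> t" "v \<notin> U" "t \<notin> U" by (auto simp: I_def T_def)
    have finU: "finite U" using i(5) by (intro card_ge_0_finite) simp
    have inj: "inj_on (\<lambda>u. {w, u}) U" for w by (auto simp: inj_on_def doubleton_eq_iff)
    have "(\<lambda>u. {v, u}) ` U \<inter> (\<lambda>u. {t, u}) ` U = {}" using i by (auto simp: doubleton_eq_iff)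
    hence "card (F i) = 6" using i finU
      by (simp add: F_def card_Un_disjoint card_image[OF inj])
    moreover have "F i \<subseteq> possible_edges n"
      unfolding i(1) F_def using i(2-) by (auto simp: pair_in_possible_edges)
    ultimately show "measure_pmf.prob (gnp n p) {G. F i \<subseteq> G} \<le> p ^ 6"
      using gnp_prob_superset[of "F i"] by simp
  qed
  also have "\<dots> \<le> n ^ 5 * p ^ 6"
    using cardI p by (intro mult_right_mono) (simp_all flip: of_nat_power)
  finally show ?thesis .
qed

end

section \<open>Excess degrees in the second neighbourhood\<close>

lemma sum_power_card_Pow:
  fixes z :: real
  assumes "finite A"
  shows "(\<Sum>S\<in>Pow A. z ^ card S) = (z + 1) ^ card A"
  using prod_add[OF assms, of "\<lambda>_. z" "\<lambda>_. 1"] by simp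

lemma one_add_power_le_exp:
  fixes z :: real and k n :: nat
  assumes "0 \<le> z" "k \<le> n"
  shows "(z + 1) ^ k \<le> exp (n * z)"
proof -
  have "(z + 1) ^ k \<le> (z + 1) ^ n" using assms by (intro power_increasing) auto
  also have "\<dots> \<le> exp z ^ n"
    using assms exp_ge_add_one_self[of z] by (intro power_mono) (auto simp: add.commute)
  finally show ?thesis by (simp add: exp_of_nat_mult)
qed

text \<open>If \<open>S\<close> is contained in the second neighbourhood of \<open>v\<close>, it is attached to \<open>v\<close> by the tree
  of edges \<open>v u\<close> and \<open>t f(t)\<close>, where \<open>f\<close> maps \<open>S\<close> to neighbours \<open>u\<close> of \<open>v\<close>. The sum of the
  maxima with 0 is at most the sum over one of the subsets \<open>S\<close>, so the moment generating
  function is bounded by summing over all such trees.\<close>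

lemma gnp_sphere2_excess_mgf:
  fixes \<theta> \<tau> p :: real and n v :: nat
  assumes p: "0 \<le> p" "p \<le> 1" and \<theta>: "\<theta> \<ge> 0" and v: "v \<in> {1..n}"
  defines "\<alpha> \<equiv> n * p * exp \<theta> * exp (n * p * ((exp (2 * \<theta>) - 1) / 2) - \<theta> * \<tau>)"
  shows "measure_pmf.expectation (gnp n p)
           (\<lambda>G. exp (\<theta> * (\<Sum>t\<in>sphere2 G v. max 0 (card (nbr G t) - \<tau>)))) \<le> exp (n * p * exp \<alpha>)"
proof -
  define \<kappa> where "\<kappa> = (exp (2 * \<theta>) - 1) / 2"
  \<comment> \<open>The weight of one vertex t of S: p for its tree edge, exp \<theta> because this
    edge counts towards the degree of t, and the moment bound for the other edges with the threshold
    \<tau> taken off.\<close>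
  define z where "z = p * exp \<theta> * exp (n * p * \<kappa> - \<theta> * \<tau>)"
  have z0: "z \<ge> 0" using p by (simp add: z_def)
  have \<alpha>: "\<alpha> = n * z" by (simp add: \<alpha>_def z_def \<kappa>_def)
  define V where "V = {1..n} - {v}"
  have V: "finite V" "card V \<le> n" "V \<subseteq> {1..n}" "v \<notin> V" using v by (auto simp: V_def)
  define X where "X = (\<lambda>S G. exp (\<Sum>t\<in>S. \<theta> * (card (nbr G t) - \<tau>)))"
  define F where "F = (\<lambda>U S f. (\<lambda>u. {v, u}) ` U \<union> (\<lambda>t. {t, f t :: nat}) ` S)"
  \<comment> \<open>U stands for the neighbourhood of v, but only the presence of the edges from v
    to U is demanded. This relaxation keeps each term a product over edges.\<close>
  define T where "T = (\<lambda>G. \<Sum>U\<in>Pow V. \<Sum>S\<in>Pow (V - U). \<Sum>f\<in>S \<rightarrow>\<^sub>E U. of_bool (F U S f \<subseteq> G) * X S G)"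
  have "exp (\<theta> * (\<Sum>t\<in>sphere2 G v. max 0 (card (nbr G t) - \<tau>))) \<le> T G"
    if G: "G \<subseteq> possible_edges n" for G
  proof -
    define A where "A = sphere2 G v"
    have finA: "finite A" unfolding A_def by (rule finite_sphere2[OF G])
    have "exp (\<theta> * (\<Sum>t\<in>A. max 0 (card (nbr G t) - \<tau>)))
        = (\<Prod>t\<in>A. exp (\<theta> * max 0 (card (nbr G t) - \<tau>)))"
      by (simp add: sum_distrib_left exp_sum[OF finA])
    also have "\<dots> \<le> (\<Prod>t\<in>A. exp (\<theta> * (card (nbr G t) - \<tau>)) + 1)"
      by (intro prod_mono) (auto simp: max_def)
    also have "\<dots> = (\<Sum>S\<in>Pow A. X S G)"
      unfolding prod_add[OF finA] X_def
      by (intro sum.cong) (auto simp: exp_sum finite_subset[OF _ finA])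
    also have "\<dots> \<le> (\<Sum>S\<in>Pow A. \<Sum>f\<in>S \<rightarrow>\<^sub>E nbr G v. of_bool (F (nbr G v) S f \<subseteq> G) * X S G)"
    proof (rule sum_mono)
      fix S assume S: "S \<in> Pow A"
      hence "\<forall>t\<in>S. \<exists>u. u \<in> nbr G v \<and> t \<in> nbr G u" by (auto simp: A_def sphere2_def)
      then obtain f where f: "\<And>t. t \<in> S \<Longrightarrow> f t \<in> nbr G v \<and> t \<in> nbr G (f t)" by metis
      have fS: "restrict f S \<in> S \<rightarrow>\<^sub>E nbr G v" using f by auto
      have "F (nbr G v) S (restrict f S) \<subseteq> G"
        using f by (auto simp: F_def nbr_def insert_commute)
      hence "X S G = of_bool (F (nbr G v) S (restrict f S) \<subseteq> G) * X S G" by simp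
      also have "\<dots> \<le> (\<Sum>f\<in>S \<rightarrow>\<^sub>E nbr G v. of_bool (F (nbr G v) S f \<subseteq> G) * X S G)"
        using fS S finA finite_nbr[OF G]
        by (intro member_le_sum) (auto simp: X_def intro!: finite_PiE finite_subset[of S A])
      finally show "X S G \<le> (\<Sum>f\<in>S \<rightarrow>\<^sub>E nbr G v. of_bool (F (nbr G v) S f \<subseteq> G) * X S G)" .
    qed
    also have "\<dots> \<le> (\<Sum>S\<in>Pow (V - nbr G v). \<Sum>f\<in>S \<rightarrow>\<^sub>E nbr G v. of_bool (F (nbr G v) S f \<subseteq> G) * X S G)"
    proof (rule sum_mono2)
      have "A \<subseteq> {1..n}" using sphere2D[OF G] by (auto simp: A_def)
      moreover have "A \<inter> insert v (nbr G v) = {}" by (auto simp: A_def sphere2_def)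
      ultimately show "Pow A \<subseteq> Pow (V - nbr G v)" by (auto simp: V_def)
    qed (use V in \<open>auto intro!: sum_nonneg simp: X_def\<close>)
    also have "\<dots> \<le> T G" unfolding T_def
    proof (rule member_le_sum[where i = "nbr G v"])
      show "nbr G v \<in> Pow V" using nbrD[OF G] by (auto simp: V_def)
    qed (use V in \<open>auto intro!: sum_nonneg simp: X_def\<close>)
    finally show ?thesis unfolding A_def .
  qed
  hence "measure_pmf.expectation (gnp n p)
      (\<lambda>G. exp (\<theta> * (\<Sum>t\<in>sphere2 G v. max 0 (card (nbr G t) - \<tau>)))) \<le> measure_pmf.expectation (gnp n p) T"
    by (rule gnp_expectation_mono)
  also have "\<dots> = (\<Sum>U\<in>Pow V. \<Sum>S\<in>Pow (V - U). \<Sum>f\<in>S \<rightarrow>\<^sub>E U.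
      measure_pmf.expectation (gnp n p) (\<lambda>G. of_bool (F U S f \<subseteq> G) * X S G))"
    unfolding T_def by (simp add: Bochner_Integration.integral_sum)
  also have "\<dots> \<le> (\<Sum>U\<in>Pow V. \<Sum>S\<in>Pow (V - U). \<Sum>f\<in>S \<rightarrow>\<^sub>E U. p ^ card U * z ^ card S)"
  proof (intro sum_mono)
    fix U S f assume U: "U \<in> Pow V" and S: "S \<in> Pow (V - U)" and f: "f \<in> S \<rightarrow>\<^sub>E U"
    have "S \<subseteq> V" using S by auto
    hence fin: "finite U" "finite S" using U finite_subset[OF _ V(1)] by auto
    have vUS: "v \<notin> U" "v \<notin> S" "U \<inter> S = {}" "U \<subseteq> {1..n}" "S \<subseteq> {1..n}" using U S V by auto
    have ft: "f t \<in> U" if "t \<in> S" for t using f that by auto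
    have inj1: "inj_on (\<lambda>u. {v, u}) U" by (auto simp: inj_on_def doubleton_eq_iff)
    have inj2: "inj_on (\<lambda>t. {t, f t}) S"
      using ft vUS(3) by (auto simp: inj_on_def doubleton_eq_iff)
    have disj: "(\<lambda>u. {v, u}) ` U \<inter> (\<lambda>t. {t, f t}) ` S = {}"
      using ft vUS by (auto simp: doubleton_eq_iff)
    have sub: "F U S f \<subseteq> possible_edges n"
    proof -
      have "{v, u} \<in> possible_edges n" if "u \<in> U" for u
        using that vUS v unfolding pair_in_possible_edges by blast
      moreover have "{t, f t} \<in> possible_edges n" if "t \<in> S" for t
        unfolding pair_in_possible_edges
        using subsetD[OF vUS(5) that] subsetD[OF vUS(4) ft[OF that]] disjoint_iff[THEN iffD1, OF vUS(3)]
          ft[OF that] that by fastforce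
      ultimately show ?thesis unfolding F_def by (intro Un_least image_subsetI)
    qed
    have cardF: "card (F U S f) = card U + card S"
      using fin disj by (simp add: F_def card_Un_disjoint card_image inj1 inj2)
    have m2: "card ({t, f t} \<inter> S) = 1" if "t \<in> S" for t
    proof -
      have "{t, f t} \<inter> S = {t}"
        using ft[OF that] that disjoint_iff[THEN iffD1, OF vUS(3)] by auto
      thus ?thesis by simp
    qed
    have m1: "card ({v, u} \<inter> S) = 0" if "u \<in> U" for u
      using that vUS(2) disjoint_iff[THEN iffD1, OF vUS(3)] by auto
    \<comment> \<open>The edges at v miss S, and each edge from t to f t meets S in t alone, so the
      forced edges contribute exp \<theta> once per vertex of S.\<close>
    have "(\<Sum>e\<in>F U S f. card (e \<inter> S))
        = (\<Sum>u\<in>U. card ({v, u} \<inter> S)) + (\<Sum>t\<in>S. card ({t, f t} \<inter> S))"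
      using fin disj unfolding F_def by (simp add: sum.union_disjoint sum.reindex[OF inj1] sum.reindex[OF inj2])
    also have "\<dots> = (\<Sum>u\<in>U. 0) + (\<Sum>t\<in>S. 1)"
      by (intro arg_cong2[where f = "(+)"] sum.cong refl m1 m2)
    finally have meet: "(\<Sum>e\<in>F U S f. card (e \<inter> S)) = card S" by simp
    have "measure_pmf.expectation (gnp n p) (\<lambda>G. of_bool (F U S f \<subseteq> G) * X S G)
        = measure_pmf.expectation (gnp n p) (\<lambda>G. exp (- (\<theta> * \<tau> * card S)) *
            (of_bool (F U S f \<subseteq> G) * exp (\<theta> * (\<Sum>t\<in>S. card (nbr G t)))))"
      by (intro Bochner_Integration.integral_cong)
        (simp_all add: X_def algebra_simps sum_subtractf sum_distrib_left mult_exp_exp exp_diff exp_minus divide_inverse)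
    also have "\<dots> = exp (- (\<theta> * \<tau> * card S)) * measure_pmf.expectation (gnp n p)
        (\<lambda>G. of_bool (F U S f \<subseteq> G) * exp (\<theta> * (\<Sum>t\<in>S. card (nbr G t))))"
      by (rule integral_mult_right_zero)
    also have "\<dots> \<le> exp (- (\<theta> * \<tau> * card S)) * (p ^ card (F U S f) *
        exp (\<theta> * (\<Sum>e\<in>F U S f. card (e \<inter> S))) * exp (p * \<kappa> * (n * card S)))"
      unfolding \<kappa>_def by (intro mult_left_mono gnp_degree_mgf p \<theta> vUS sub) auto
    also have "\<dots> = p ^ card U * (p ^ card S *
        (exp (card S * \<theta>) * exp (card S * (n * p * \<kappa> - \<theta> * \<tau>))))"
      unfolding cardF meet by (simp add: power_add mult_exp_exp algebra_simps)
    also have "\<dots> = p ^ card U * z ^ card S"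
      by (simp add: z_def power_mult_distrib exp_of_nat_mult)
    finally show "measure_pmf.expectation (gnp n p) (\<lambda>G. of_bool (F U S f \<subseteq> G) * X S G)
        \<le> p ^ card U * z ^ card S" .
  qed
  \<comment> \<open>The summand does not depend on f, and there are card U ^ card S choices of
    f.\<close>
  also have "\<dots> = (\<Sum>U\<in>Pow V. p ^ card U * (\<Sum>S\<in>Pow (V - U). (card U * z) ^ card S))"
  proof (intro sum.cong refl, unfold sum_distrib_left, intro sum.cong refl)
    fix U S assume "U \<in> Pow V" "S \<in> Pow (V - U)"
    hence "finite S" using V finite_subset[of S V] by auto
    thus "(\<Sum>f\<in>S \<rightarrow>\<^sub>E U. p ^ card U * z ^ card S) = p ^ card U * (card U * z) ^ card S"
      by (simp add: card_PiE power_mult_distrib)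
  qed
  \<comment> \<open>The second generation costs a factor exp \<alpha> per neighbour of v. Summing
    over U then treats the first generation alike, giving a nested exponential as for a two-step
    branching process.\<close>
  also have "\<dots> \<le> (\<Sum>U\<in>Pow V. p ^ card U * exp \<alpha> ^ card U)"
  proof (intro sum_mono mult_left_mono)
    fix U assume "U \<in> Pow V"
    hence "card (V - U) \<le> n" using card_mono[OF V(1), of "V - U"] V(2) by auto
    hence "(card U * z + 1) ^ card (V - U) \<le> exp (n * (card U * z))"
      using z0 by (intro one_add_power_le_exp) auto
    thus "(\<Sum>S\<in>Pow (V - U). (card U * z) ^ card S) \<le> exp \<alpha> ^ card U"
      using V by (simp add: sum_power_card_Pow \<alpha> exp_of_nat_mult[symmetric] mult_ac)
  qed (use p in auto)
  also have "\<dots> = (p * exp \<alpha> + 1) ^ card V"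
    using sum_power_card_Pow[OF V(1), of "p * exp \<alpha>"] by (simp add: power_mult_distrib)
  also have "\<dots> \<le> exp (n * (p * exp \<alpha>))"
    using p V by (intro one_add_power_le_exp) auto
  finally show ?thesis by (simp add: mult.assoc)
qed

text \<open>The condition with ln 2 means exp \<alpha> \<le> 2, which caps the nested exponential at
  exp (2 n p). Markov's inequality and a union bound over v give the rest.\<close>

lemma gnp_sphere2_excess_tail:
  fixes \<theta> \<tau> p L :: real and n :: nat
  assumes p: "0 \<le> p" "p \<le> 1" and \<theta>: "\<theta> \<ge> 0"
    and \<alpha>: "n * p * exp \<theta> * exp (n * p * ((exp (2 * \<theta>) - 1) / 2) - \<theta> * \<tau>) \<le> ln 2"
  shows "measure_pmf.prob (gnp n p)
      {G. \<exists>v\<in>{1..n}. \<not> (\<Sum>t\<in>sphere2 G v. max 0 (card (nbr G t) - \<tau>)) \<le> L}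
    \<le> n * exp (2 * (n * p) - \<theta> * L)"
proof -
  define Z where "Z = (\<lambda>v G. \<Sum>t\<in>sphere2 G v. max 0 (card (nbr G t) - \<tau>))"
  have "measure_pmf.prob (gnp n p) (\<Union>v\<in>{1..n}. {G. \<not> Z v G \<le> L})
      \<le> card {1..n} * exp (2 * (n * p) - \<theta> * L)"
  proof (rule gnp_prob_UN_le)
    fix v assume v: "v \<in> {1..n}"
    have "measure_pmf.prob (gnp n p) {G. \<not> Z v G \<le> L}
        \<le> measure_pmf.expectation (gnp n p) (\<lambda>G. exp (- (\<theta> * L)) * exp (\<theta> * Z v G))"
    proof (rule gnp_prob_le_expectation)
      fix G :: "nat set set"
      have "\<theta> * L \<le> \<theta> * Z v G" if "\<not> Z v G \<le> L" using that \<theta> by (intro mult_left_mono) auto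
      thus "of_bool (G \<in> {G. \<not> Z v G \<le> L}) \<le> exp (- (\<theta> * L)) * exp (\<theta> * Z v G)"
        by (auto simp: mult_exp_exp)
    qed
    also have "\<dots> = exp (- (\<theta> * L)) * measure_pmf.expectation (gnp n p) (\<lambda>G. exp (\<theta> * Z v G))"
      by (rule integral_mult_right_zero)
    also have "\<dots> \<le> exp (- (\<theta> * L)) * exp (n * p * exp (ln 2))"
    proof (rule mult_left_mono)
      have "exp (n * p * exp (n * p * exp \<theta> * exp (n * p * ((exp (2 * \<theta>) - 1) / 2) - \<theta> * \<tau>)))
          \<le> exp (n * p * exp (ln 2))"
        using p \<alpha> by (intro iffD2[OF exp_le_cancel_iff] mult_left_mono) auto
      thus "measure_pmf.expectation (gnp n p) (\<lambda>G. exp (\<theta> * Z v G)) \<le> exp (n * p * exp (ln 2))"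
        using gnp_sphere2_excess_mgf[OF p \<theta> v, of \<tau>] unfolding Z_def by (rule order_trans[rotated])
    qed simp
    also have "\<dots> = exp (2 * (n * p) - \<theta> * L)" by (simp add: mult_exp_exp algebra_simps)
    finally show "measure_pmf.prob (gnp n p) {G. \<not> Z v G \<le> L} \<le> exp (2 * (n * p) - \<theta> * L)" .
  qed simp
  moreover have "(\<Union>v\<in>{1..n}. {G. \<not> Z v G \<le> L}) = {G. \<exists>v\<in>{1..n}. \<not> Z v G \<le> L}" by auto
  ultimately show ?thesis by (simp add: Z_def)
qed

section \<open>Lower tails of the maximum and average degree\<close>

lemma prob_pair_pmf_Times:
  "measure_pmf.prob (pair_pmf M N) (A \<times> B) = measure_pmf.prob M A * measure_pmf.prob N B"
proof -
  have "measure_pmf.prob (pair_pmf M N) (A \<times> B)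
      = measure_pmf.prob (pair_pmf M N) ((A \<inter> set_pmf M) \<times> (B \<inter> set_pmf N))"
    by (subst measure_Int_set_pmf[symmetric]) (auto intro!: arg_cong[where f = "measure_pmf.prob _"])
  also have "\<dots> = measure_pmf.prob M (A \<inter> set_pmf M) * measure_pmf.prob N (B \<inter> set_pmf N)"
    by (intro measure_pmf_prob_product countable_Int2) auto
  finally show ?thesis by (simp add: measure_Int_set_pmf)
qed

text \<open>Induction on the blocks, splitting the product measure in two. Each \<open>Q i\<close>
  is a predicate on whole functions that looks only at the coordinates in
  \<open>K i\<close>.\<close>

lemma prob_Pi_pmf_disjoint_blocks:
  assumes "finite I" and "\<And>i. i \<in> I \<Longrightarrow> finite (K i)"
    and "\<And>i j. i \<in> I \<Longrightarrow> j \<in> I \<Longrightarrow> i \<noteq> j \<Longrightarrow> K i \<inter> K j = {}"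
    and "\<And>i f g. i \<in> I \<Longrightarrow> (\<And>x. x \<in> K i \<Longrightarrow> f x = g x) \<Longrightarrow> Q i f = Q i g"
  shows "measure_pmf.prob (Pi_pmf (\<Union>i\<in>I. K i) d p) {f. \<forall>i\<in>I. Q i f}
       = (\<Prod>i\<in>I. measure_pmf.prob (Pi_pmf (K i) d p) {f. Q i f})"
  using assms
proof (induction rule: finite_induct)
  case (insert i I)
  define B where "B = (\<Union>j\<in>I. K j)"
  have fin: "finite (K i)" "finite B" using insert.prems(1) insert.hyps by (auto simp: B_def)
  have disj: "K i \<inter> B = {}" using insert.prems(2)[of i] insert.hyps by (fastforce simp: B_def)
  have U: "(\<Union>j\<in>insert i I. K j) = K i \<union> B" by (simp add: B_def)
  have "(\<lambda>(f, g) x. if x \<in> K i then f x else g x) -` {f. \<forall>j\<in>insert i I. Q j f}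
      = {f. Q i f} \<times> {f. \<forall>j\<in>I. Q j f}"
  proof -
    have "Q i (\<lambda>x. if x \<in> K i then f x else g x) = Q i f" for f g
      by (rule insert.prems(3)) auto
    moreover have "Q j (\<lambda>x. if x \<in> K i then f x else g x) = Q j g" if "j \<in> I" for f g j
      using that disj by (intro insert.prems(3)) (auto simp: B_def)
    ultimately show ?thesis by auto
  qed
  hence "measure_pmf.prob (Pi_pmf (\<Union>j\<in>insert i I. K j) d p) {f. \<forall>j\<in>insert i I. Q j f}
      = measure_pmf.prob (pair_pmf (Pi_pmf (K i) d p) (Pi_pmf B d p)) ({f. Q i f} \<times> {f. \<forall>j\<in>I. Q j f})"
    unfolding U Pi_pmf_union[OF fin disj] measure_map_pmf by (simp only:)
  also have "\<dots> = measure_pmf.prob (Pi_pmf (K i) d p) {f. Q i f}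
      * measure_pmf.prob (Pi_pmf B d p) {f. \<forall>j\<in>I. Q j f}"
    by (rule prob_pair_pmf_Times)
  also have "measure_pmf.prob (Pi_pmf B d p) {f. \<forall>j\<in>I. Q j f}
      = (\<Prod>i\<in>I. measure_pmf.prob (Pi_pmf (K i) d p) {f. Q i f})"
    unfolding B_def by (intro insert.IH insert.prems) auto
  finally show ?case using insert.hyps by simp
qed simp

text \<open>The numbers of neighbours in the second half of the vertex set are independent for the
  vertices of the first half.\<close>

lemma gnp_max_degree_lower_tail_binomial:
  fixes p :: real and n m D :: nat
  assumes p: "0 \<le> p" "p \<le> 1" and n: "n > 0" and m: "m \<le> n"
  shows "measure_pmf.prob (gnp n p) {G. max_degree n G < D}
    \<le> (1 - ((n - m) choose D) * p ^ D * (1 - p) ^ (n - m - D)) ^ m"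
proof -
  define K where "K = (\<lambda>v. (\<lambda>w. {v, w :: nat}) ` {m+1..n})"
  define Q where "Q = (\<lambda>v f. card {e \<in> K v. f e} < D)"
  define q where "q = ((n - m) choose D) * p ^ D * (1 - p) ^ (n - m - D)"
  let ?b = "\<lambda>_ :: nat set. bernoulli_pmf p"
  have inj: "inj_on (\<lambda>w. {v, w}) A" for v :: nat and A by (auto simp: inj_on_def doubleton_eq_iff)
  have finK: "finite (K v)" for v by (simp add: K_def)
  have cardK: "card (K v) = n - m" for v by (simp add: K_def card_image inj)
  have disj: "K v \<inter> K w = {}" if "v \<in> {1..m}" "w \<in> {1..m}" "v \<noteq> w" for v w
    using that by (auto simp: K_def doubleton_eq_iff)
  have K_sub: "(\<Union>v\<in>{1..m}. K v) \<subseteq> possible_edges n"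
    using m by (auto simp: K_def pair_in_possible_edges)
  have Qcong: "Q v f = Q v g" if "\<And>x. x \<in> K v \<Longrightarrow> f x = g x" for v f g
    unfolding Q_def using that by (intro arg_cong[where f = "\<lambda>A. card A < D"]) auto
  have one: "measure_pmf.prob (Pi_pmf (K v) False ?b) {f. Q v f} \<le> 1 - q" for v
  proof -
    have "measure_pmf.prob (Pi_pmf (K v) False ?b) {f. Q v f}
        = measure_pmf.prob (binomial_pmf (n - m) p) {..<D}"
      using binomial_pmf_altdef'[OF finK cardK, of p v False] p
      by (simp add: Q_def vimage_def measure_map_pmf lessThan_def)
    \<comment> \<open>Of the upper tail only the weight of D itself is kept. In the applications D
      lies above the mean, and this single weight is large enough.\<close>
    also have "\<dots> \<le> measure_pmf.prob (binomial_pmf (n - m) p) (UNIV - {D})"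
      by (rule measure_pmf.finite_measure_mono) auto
    also have "\<dots> = 1 - pmf (binomial_pmf (n - m) p) D"
      using measure_pmf.prob_compl[of "{D}" "binomial_pmf (n - m) p"] by (simp add: measure_pmf_single)
    finally show ?thesis using p by (simp add: q_def pmf_binomial)
  qed
  have "measure_pmf.prob (gnp n p) {G. max_degree n G < D}
      \<le> measure_pmf.prob (gnp n p) {G. \<forall>v\<in>{1..m}. Q v (\<lambda>e. e \<in> G)}"
  proof (rule gnp_prob_mono)
    fix G assume G: "G \<subseteq> possible_edges n" "G \<in> {G. max_degree n G < D}"
    have "card {e \<in> K v. e \<in> G} < D" if "v \<in> {1..m}" for v
    proof -
      have "card {e \<in> K v. e \<in> G} \<le> card {e \<in> G. v \<in> e}"
        using finite_subset[OF G(1) finite_possible_edges] by (intro card_mono) (auto simp: K_def)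
      also have "\<dots> \<le> max_degree n G"
        using that m card_nbr_le_max_degree[OF G(1), of v] by (simp add: card_incident_edges[OF G(1)])
      finally show ?thesis using G(2) by simp
    qed
    thus "G \<in> {G. \<forall>v\<in>{1..m}. Q v (\<lambda>e. e \<in> G)}" by (simp add: Q_def)
  qed
  also have "\<dots> = measure_pmf.prob (Pi_pmf (possible_edges n) False ?b) {f. \<forall>v\<in>{1..m}. Q v f}"
  proof -
    have "Q v (\<lambda>e. e \<in> {e \<in> possible_edges n. f e}) = Q v f" if "v \<in> {1..m}" for v f
    proof (rule Qcong)
      fix e assume "e \<in> K v"
      hence "e \<in> possible_edges n" using K_sub that by blast
      thus "(e \<in> {e \<in> possible_edges n. f e}) = f e" by simp
    qed
    thus ?thesis unfolding gnp_def measure_map_pmf vimage_def by simp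
  qed
  also have "\<dots> = measure_pmf.prob (Pi_pmf (\<Union>v\<in>{1..m}. K v) False ?b) {f. \<forall>v\<in>{1..m}. Q v f}"
  proof -
    have "Q v (\<lambda>x. if x \<in> (\<Union>v\<in>{1..m}. K v) then f x else False) = Q v f" if "v \<in> {1..m}" for v f
      using that by (intro Qcong) auto
    thus ?thesis
      unfolding Pi_pmf_subset[OF finite_possible_edges K_sub] measure_map_pmf vimage_def by simp
  qed
  also have "\<dots> = (\<Prod>v\<in>{1..m}. measure_pmf.prob (Pi_pmf (K v) False ?b) {f. Q v f})"
    by (rule prob_Pi_pmf_disjoint_blocks[OF _ finK disj Qcong]) simp_all
  also have "\<dots> \<le> (\<Prod>v\<in>{1..m}. 1 - q)" by (intro prod_mono) (use one in auto)
  finally show ?thesis by (simp add: q_def)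
qed

lemma one_minus_ge_exp:
  fixes p :: real
  assumes "0 \<le> p" "p \<le> 1 / 2"
  shows "exp (- 2 * p) \<le> 1 - p"
proof -
  have "p * p \<le> p * (1 / 2)" using assms by (intro mult_left_mono) auto
  hence "- 2 * p \<le> - p - 2 * p\<^sup>2" by (simp add: power2_eq_square)
  also have "\<dots> \<le> ln (1 - p)" using assms by (intro ln_one_minus_pos_lower_bound)
  finally show ?thesis using assms by (subst ln_ge_iff[symmetric]) auto
qed

lemma gnp_max_degree_lower_tail:
  fixes p :: real
  assumes p: "0 \<le> p" "p \<le> 1 / 2" and n: "n \<ge> 2" and D: "1 \<le> D" "2 * D \<le> n"
  shows "measure_pmf.prob (gnp n p) {G. max_degree n G < D}
    \<le> exp (- (n / 4) * ((n * p / (2 * D)) ^ D * exp (- 2 * (n * p))))"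
proof -
  \<comment> \<open>Halving leaves at least n / 4 independent vertices, each with at least n / 2
    potential neighbours.\<close>
  define m where "m = n div 2"
  have m: "m \<le> n" "n \<le> 2 * (n - m)" "n \<le> 4 * m" "D \<le> n - m" using n D by (auto simp: m_def)
  define q where "q = ((n - m) choose D) * p ^ D * (1 - p) ^ (n - m - D)"
  define r where "r = (n * p / (2 * D)) ^ D * exp (- 2 * (n * p))"
  have r0: "r \<ge> 0" using p by (simp add: r_def)
  have "real n / (2 * D) \<le> real (n - m) / D"
    using m(2) D by (simp add: field_simps)
  hence "(real n / (2 * D)) ^ D \<le> (real (n - m) / D) ^ D" by (intro power_mono) auto
  also have "\<dots> \<le> (n - m) choose D" using m by (intro binomial_ge_n_over_k_pow_k)
  finally have choose: "(real n / (2 * D)) ^ D \<le> (n - m) choose D" .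
  have "exp (- 2 * (n * p)) = exp (- 2 * p) ^ n" by (simp add: exp_of_nat_mult[symmetric] mult_ac)
  also have "\<dots> \<le> (1 - p) ^ n" using one_minus_ge_exp[OF p] by (intro power_mono) auto
  also have "\<dots> \<le> (1 - p) ^ (n - m - D)" using p by (intro power_decreasing) auto
  finally have rest: "exp (- 2 * (n * p)) \<le> (1 - p) ^ (n - m - D)" .
  have "r = (real n / (2 * D)) ^ D * p ^ D * exp (- 2 * (n * p))"
    by (simp add: r_def power_mult_distrib[symmetric])
  also have "\<dots> \<le> q" unfolding q_def
    using p choose rest by (intro mult_mono) auto
  finally have rq: "r \<le> q" .
  have "measure_pmf.prob (gnp n p) {G. max_degree n G < D} \<le> (1 - q) ^ m"
    unfolding q_def using p n m by (intro gnp_max_degree_lower_tail_binomial) auto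
  also have "\<dots> \<le> exp (- q) ^ m"
  proof (rule power_mono)
    show "1 - q \<le> exp (- q)" using exp_ge_add_one_self[of "- q"] by simp
    show "0 \<le> 1 - q" using pmf_le_1[of "binomial_pmf (n - m) p" D] p by (simp add: q_def pmf_binomial)
  qed
  also have "\<dots> = exp (- (m * q))" by (simp add: exp_of_nat_mult[symmetric])
  also have "\<dots> \<le> exp (- (n / 4 * r))"
  proof -
    have "n / 4 \<le> m" using m(3) by simp
    hence "n / 4 * r \<le> m * q" using rq r0 by (intro mult_mono) auto
    thus ?thesis by simp
  qed
  finally show ?thesis by (simp add: r_def)
qed

text \<open>Chernoff bound for the number of edges with tilt \<eta> / 2. The size condition on n
  covers the difference between n (n - 1) and n^2.\<close>

lemma gnp_average_degree_lower_tail: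
  fixes p \<eta> :: real
  assumes p: "0 \<le> p" "p \<le> 1" and \<eta>: "0 < \<eta>" "\<eta> \<le> 1" and n: "4 / \<eta> \<le> n"
  shows "measure_pmf.prob (gnp n p) {G. 2 * card G / n < (1 - \<eta>) * (n * p)}
    \<le> exp (- (n * (n * p) * \<eta>\<^sup>2 / 32))"
proof -
  define \<theta> where "\<theta> = \<eta> / 2"
  define c where "c = (1 - \<eta>) * (n * p) * n / 2"
  define \<beta> where "\<beta> = 1 - exp (- \<theta>)"
  have n0: "n > 0" using n \<eta> by (cases "n = 0") (auto simp: field_simps)
  have \<theta>0: "\<theta> > 0" using \<eta> by (simp add: \<theta>_def)
  have cardPE: "real (card (possible_edges n)) = n * (n - 1) / 2"
  proof -
    have "card (possible_edges n) = n choose 2"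
      unfolding possible_edges_def by (subst n_subsets) auto
    moreover have "2 * (n choose 2) = n * (n - 1)"
      unfolding choose_two by (rule dvd_mult_div_cancel) (cases n; auto)
    ultimately have "real (2 * card (possible_edges n)) = real (n * (n - 1))" by (simp only:)
    thus ?thesis using n0 by (simp add: of_nat_diff)
  qed
  have "measure_pmf.prob (gnp n p) {G. 2 * card G / n < (1 - \<eta>) * (n * p)}
      \<le> measure_pmf.expectation (gnp n p)
          (\<lambda>G. exp (\<theta> * c) * (\<Prod>e\<in>possible_edges n. if e \<in> G then exp (- \<theta>) else 1))"
  proof (rule gnp_prob_le_expectation)
    fix G assume G: "G \<subseteq> possible_edges n"
    have "(\<Prod>e\<in>possible_edges n. if e \<in> G then exp (- \<theta>) else 1) = (\<Prod>e\<in>possible_edges n \<inter> G. exp (- \<theta>))"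
      by (rule prod.inter_restrict[symmetric]) simp
    also have "possible_edges n \<inter> G = G" using G by blast
    also have "(\<Prod>e\<in>G. exp (- \<theta>)) = exp (- \<theta> * card G)"
      by (simp add: exp_of_nat_mult[symmetric] mult.commute)
    finally have P: "(\<Prod>e\<in>possible_edges n. if e \<in> G then exp (- \<theta>) else 1) = exp (- \<theta> * card G)" .
    have "\<theta> * card G \<le> \<theta> * c" if "2 * card G / n < (1 - \<eta>) * (n * p)"
    proof (rule mult_left_mono)
      show "card G \<le> c" using that n0 by (simp add: c_def field_simps)
    qed (use \<theta>0 in simp)
    thus "of_bool (G \<in> {G. 2 * card G / n < (1 - \<eta>) * (n * p)})
      \<le> exp (\<theta> * c) * (\<Prod>e\<in>possible_edges n. if e \<in> G then exp (- \<theta>) else 1)"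
      unfolding P by (auto simp: mult_exp_exp)
  qed
  also have "\<dots> = exp (\<theta> * c) * (\<Prod>e\<in>possible_edges n. p * exp (- \<theta>) + (1 - p) * 1)"
    unfolding integral_mult_right_zero
    by (subst gnp_expectation_prod[OF p, of "\<lambda>e b. if b then exp (- \<theta>) else 1"]) simp_all
  also have "\<dots> = exp (\<theta> * c) * (1 - p * \<beta>) ^ card (possible_edges n)"
    by (simp add: \<beta>_def algebra_simps)
  also have "\<dots> \<le> exp (\<theta> * c) * exp (- (p * \<beta>)) ^ card (possible_edges n)"
  proof (intro mult_left_mono power_mono)
    show "1 - p * \<beta> \<le> exp (- (p * \<beta>))" using exp_ge_add_one_self[of "- (p * \<beta>)"] by simp
    have "p * \<beta> \<le> 1 * 1" using p \<theta>0 by (intro mult_mono) (auto simp: \<beta>_def)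
    thus "0 \<le> 1 - p * \<beta>" by simp
  qed auto
  also have "\<dots> = exp (\<theta> * c - n * (n - 1) / 2 * p * \<beta>)"
    unfolding exp_of_nat_mult[symmetric] cardPE mult_exp_exp by (simp add: mult.assoc)
  also have "\<dots> \<le> exp (- (n * (n * p) * \<eta>\<^sup>2 / 32))"
  proof (rule iffD2[OF exp_le_cancel_iff])
    \<comment> \<open>Bounding \<beta> below by \<theta> / (1 + \<theta>) makes the comparison of
      exponents a polynomial inequality in \<eta>, once multiplied by 1 + \<theta>.\<close>
    have "1 + \<theta> \<le> exp \<theta>" by (rule exp_ge_add_one_self)
    hence "inverse (exp \<theta>) \<le> inverse (1 + \<theta>)" using \<theta>0 by (intro le_imp_inverse_le) auto
    hence "1 - inverse (1 + \<theta>) \<le> \<beta>" by (simp add: \<beta>_def exp_minus)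
    moreover have "1 - inverse (1 + \<theta>) = \<theta> / (1 + \<theta>)" using \<theta>0 by (simp add: field_simps)
    ultimately have \<beta>: "\<theta> \<le> \<beta> * (1 + \<theta>)" using \<theta>0 by (simp add: pos_divide_le_eq)
    have d0: "n * (n * p) / 2 \<ge> 0" using p by simp
    \<comment> \<open>The relative loss from n - 1 in place of n; at most \<eta> / 4, it uses up
      half of the linear gain \<eta> / 2.\<close>
    define i where "i = 1 / real n"
    have ni: "real n * i = 1" using n0 by (simp add: i_def)
    have inv: "i \<le> \<eta> / 4" using n \<eta> n0 by (simp add: i_def field_simps)
    have n1: "1 - i \<ge> 0" using n0 by (simp add: i_def field_simps)
    have "(\<theta> * (1 - \<eta>) - (1 - i) * \<beta>) * (1 + \<theta>)
        = \<theta> * ((1 - \<eta>) * (1 + \<theta>)) - (1 - i) * (\<beta> * (1 + \<theta>))" by (simp add: algebra_simps)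
    also have "\<dots> \<le> \<theta> * ((1 - \<eta>) * (1 + \<theta>)) - (1 - i) * \<theta>"
      using \<beta> n1 by (intro diff_left_mono mult_left_mono)
    also have "\<dots> = \<theta> * ((1 - \<eta>) * (1 + \<theta>) - 1 + i)" by (simp add: algebra_simps)
    also have "\<dots> \<le> \<theta> * (- (\<eta> / 4))"
    proof (rule mult_left_mono)
      have "(1 - \<eta>) * (1 + \<theta>) - 1 = - (\<eta> / 2) - \<eta>\<^sup>2 / 2"
        by (simp add: \<theta>_def field_simps power2_eq_square)
      moreover have "0 \<le> \<eta>\<^sup>2 / 2" by simp
      ultimately show "(1 - \<eta>) * (1 + \<theta>) - 1 + i \<le> - (\<eta> / 4)" using inv by linarith
    qed (use \<theta>0 in simp)
    also have "\<dots> = - (\<eta>\<^sup>2 / 16) * 2" by (simp add: \<theta>_def power2_eq_square)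
    also have "\<dots> \<le> - (\<eta>\<^sup>2 / 16) * (1 + \<theta>)"
      using \<eta> by (intro mult_left_mono_neg) (auto simp: \<theta>_def)
    finally have "\<theta> * (1 - \<eta>) - (1 - i) * \<beta> \<le> - (\<eta>\<^sup>2 / 16)"
      by (rule mult_right_le_imp_le) (use \<theta>0 in simp)
    hence "n * (n * p) / 2 * (\<theta> * (1 - \<eta>) - (1 - i) * \<beta>) \<le> n * (n * p) / 2 * - (\<eta>\<^sup>2 / 16)"
      using d0 by (intro mult_left_mono)
    also have "n * (n * p) / 2 * - (\<eta>\<^sup>2 / 16) = - (n * (n * p) * \<eta>\<^sup>2 / 32)" by simp
    also have "n * (n * p) / 2 * (\<theta> * (1 - \<eta>) - (1 - i) * \<beta>) = \<theta> * c - n * (n - 1) / 2 * p * \<beta>"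
    proof -
      have nn: "real (n * (n - 1)) = n * n - n * (n * i)" using n0 ni by (simp add: of_nat_diff algebra_simps)
      show ?thesis unfolding c_def nn
        by (simp add: algebra_simps add_divide_distrib diff_divide_distrib)
    qed
    finally show "\<theta> * c - n * (n - 1) / 2 * p * \<beta> \<le> - (n * (n * p) * \<eta>\<^sup>2 / 32)" .
  qed
  finally show ?thesis .
qed

section \<open>Upper bounds for the largest eigenvalue\<close>

definition spectral_scale :: "nat \<Rightarrow> real \<Rightarrow> nat set set \<Rightarrow> real" where
  "spectral_scale n p G = max (sqrt (real (max_degree n G))) (real n * p)"

lemma mult_exp_minus_two_ln:
  assumes "n > 0"
  shows "real n * exp (- (2 * ln n)) = 1 / n"
proof -
  have "exp (2 * ln (real n)) = real n * real n" unfolding mult_2 exp_add using assms by simp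
  thus ?thesis using assms by (simp add: exp_minus field_simps)
qed

lemma gnp_codegree_tail_average_degree:
  assumes p: "0 \<le> p" "p \<le> 1" and n: "n > 0"
  shows "measure_pmf.prob (gnp n p)
     {G. \<exists>v\<in>{1..n}. \<exists>t\<in>{1..n}. v \<noteq> t \<and> \<not> card (nbr G v \<inter> nbr G t) \<le> 2} \<le> (n * p) ^ 6 / n"
proof -
  have "real n ^ 5 * p ^ 6 = (n * p) ^ 6 / n"
    using n by (simp add: power_mult_distrib field_simps eval_nat_numeral)
  thus ?thesis using gnp_codegree_tail[OF p, of n] by simp
qed

text \<open>The quantity \<open>y\<close> is a deterministic lower bound for the random \<open>spectral_scale\<close>, valid when the
  maximum degree is at least \<open>D\<close>.\<close>

lemma prob_large_eigenvalue_le: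
  fixes p \<eta> \<theta> K y :: real and n D :: nat
  assumes p: "0 \<le> p" "p \<le> 1" and n: "n > 0" and \<eta>: "0 < \<eta>" and \<theta>: "\<theta> \<ge> 0"
    and y: "y = max K (max (n * p) (sqrt D))" and K: "2 / \<eta> \<le> K"
    and \<alpha>: "n * p * exp \<theta> * exp (n * p * ((exp (2 * \<theta>) - 1) / 2) - \<theta> * ((1 + \<eta> / 2) * y)) \<le> ln 2"
    and L: "2 * (n * p) + 2 * ln n \<le> \<theta> * (\<eta>\<^sup>2 * y ^ 3 / 4)"
  shows "measure_pmf.prob (gnp n p)
      {G. K \<le> spectral_scale n p G \<and> (1 + \<eta>) * spectral_scale n p G < largest_eigenvalue n G}
    \<le> measure_pmf.prob (gnp n p) {G. max_degree n G < D} + (n * p) ^ 6 / n + 1 / n"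
proof -
  let ?P = "measure_pmf.prob (gnp n p)"
  let ?bad = "{G. K \<le> spectral_scale n p G \<and> (1 + \<eta>) * spectral_scale n p G < largest_eigenvalue n G}"
  define \<tau> where "\<tau> = (1 + \<eta> / 2) * y"
  define A where "A = {G. \<exists>v\<in>{1..n}. \<exists>t\<in>{1..n}. v \<noteq> t \<and> \<not> card (nbr G v \<inter> nbr G t) \<le> 2}"
  define B where "B = {G. \<exists>v\<in>{1..n}. \<not> (\<Sum>t\<in>sphere2 G v. max 0 (card (nbr G t) - \<tau>)) \<le> \<eta>\<^sup>2 * y ^ 3 / 4}"
  have "0 < 2 / \<eta>" using \<eta> by simp
  hence y0: "0 \<le> y" using K unfolding y by linarith
  have "?P ?bad \<le> ?P ({G. max_degree n G < D} \<union> A \<union> B)"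
  proof (rule gnp_prob_mono)
    fix G assume G: "G \<subseteq> possible_edges n" and "G \<in> ?bad"
    hence bad: "K \<le> spectral_scale n p G" "(1 + \<eta>) * spectral_scale n p G < largest_eigenvalue n G" by auto
    show "G \<in> {G. max_degree n G < D} \<union> A \<union> B"
    proof (rule ccontr)
      assume "\<not> ?thesis"
      hence D: "D \<le> max_degree n G" and "G \<notin> A" and "G \<notin> B" by auto
      from \<open>G \<notin> A\<close> have nA: "\<forall>v\<in>{1..n}. \<forall>t\<in>{1..n}. v \<noteq> t \<longrightarrow> card (nbr G v \<inter> nbr G t) \<le> 2"
        unfolding A_def mem_Collect_eq by blast
      from \<open>G \<notin> B\<close> have nB:
        "\<forall>v\<in>{1..n}. (\<Sum>t\<in>sphere2 G v. max 0 (card (nbr G t) - \<tau>)) \<le> \<eta>\<^sup>2 * y ^ 3 / 4"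
        unfolding B_def mem_Collect_eq by blast
      have "sqrt D \<le> sqrt (max_degree n G)" using D by simp
      \<comment> \<open>\<open>K\<close> may enter \<open>y\<close> because the event only concerns
        graphs of scale at least \<open>K\<close>; this keeps \<open>y\<close> large even if
        \<open>n * p\<close> and \<open>D\<close> are small.\<close>
      hence yx: "y \<le> spectral_scale n p G" using bad(1) unfolding y spectral_scale_def by linarith
      have "largest_eigenvalue n G \<le> (1 + \<eta>) * spectral_scale n p G"
      proof (rule largest_eigenvalue_le_of_small_excess[OF G n \<eta>])
        show "2 / \<eta> \<le> spectral_scale n p G" using K bad(1) by simp
        have "sqrt (max_degree n G) ^ 2 \<le> (spectral_scale n p G)\<^sup>2" by (rule power_mono) (simp_all add: spectral_scale_def)
        thus "real (max_degree n G) \<le> (spectral_scale n p G)\<^sup>2" by simp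
      next
        fix v t assume "v \<in> {1..n}" "t \<in> {1..n}" "v \<noteq> t"
        thus "card (nbr G v \<inter> nbr G t) \<le> 2" using nA by (elim ballE) auto
      next
        fix v assume v: "v \<in> {1..n}"
        have "\<tau> \<le> (1 + \<eta> / 2) * spectral_scale n p G"
          unfolding \<tau>_def using yx \<eta> by (intro mult_left_mono) auto
        hence "(\<Sum>t\<in>sphere2 G v. max 0 (card (nbr G t) - (1 + \<eta> / 2) * spectral_scale n p G))
            \<le> (\<Sum>t\<in>sphere2 G v. max 0 (card (nbr G t) - \<tau>))"
          by (intro sum_mono) auto
        also have "\<dots> \<le> \<eta>\<^sup>2 * y ^ 3 / 4" using nB v by (rule bspec)
        also have "\<dots> \<le> \<eta>\<^sup>2 * spectral_scale n p G ^ 3 / 4"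
          using yx y0 by (intro divide_right_mono mult_left_mono power_mono) auto
        finally show "(\<Sum>t\<in>sphere2 G v. max 0 (card (nbr G t) - (1 + \<eta> / 2) * spectral_scale n p G))
            \<le> \<eta>\<^sup>2 * spectral_scale n p G ^ 3 / 4" .
      qed
      thus False using bad(2) by simp
    qed
  qed
  also have "\<dots> \<le> ?P ({G. max_degree n G < D} \<union> A) + ?P B"
    by (rule measure_Un_le) auto
  also have "\<dots> \<le> (?P {G. max_degree n G < D} + ?P A) + ?P B"
    by (intro add_right_mono measure_Un_le) auto
  also have "\<dots> \<le> ?P {G. max_degree n G < D} + (n * p) ^ 6 / n + 1 / n"
  proof (intro add_mono order_refl)
    show "?P A \<le> (n * p) ^ 6 / n" unfolding A_def by (rule gnp_codegree_tail_average_degree[OF p n])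
    have "?P B \<le> n * exp (2 * (n * p) - \<theta> * (\<eta>\<^sup>2 * y ^ 3 / 4))"
      unfolding B_def by (rule gnp_sphere2_excess_tail[OF p \<theta>]) (use \<alpha> in \<open>simp add: \<tau>_def\<close>)
    \<comment> \<open>One \<open>ln n\<close> pays for the union over all vertices, the other leaves
      1 / n.\<close>
    also have "\<dots> \<le> n * exp (- (2 * ln n))" using L by (intro mult_left_mono) auto
    also have "\<dots> = 1 / n" by (rule mult_exp_minus_two_ln[OF n])
    finally show "?P B \<le> 1 / n" .
  qed
  finally show ?thesis .
qed

section \<open>Average degree above a multiple of \<open>ln n\<close>\<close>

lemma half_exp_minus_one_le:
  fixes \<eta> :: real
  assumes "0 < \<eta>" "\<eta> \<le> 1"
  shows "(exp (2 * (\<eta> / 8)) - 1) / 2 \<le> \<eta> / 8 * (1 + \<eta> / 4)"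
proof -
  \<comment> \<open>At tilt \<eta> / 8 the moment bound exceeds its linear part by a factor 1 +
    \<eta> / 4 only, half of the relative margin in the threshold (1 + \<eta> / 2) y.\<close>
  have "exp (\<eta> / 4) \<le> 1 + \<eta> / 4 + (\<eta> / 4)\<^sup>2" using assms by (intro exp_bound) auto
  thus ?thesis by (simp add: field_simps power2_eq_square)
qed

text \<open>The largest eigenvalue is at most the maximum degree, and here a degree reaches (1 +
  \<eta>) n p with probability at most n^(-2): the Chernoff exponent 3 \<eta>^2 n p / 32 is at least
  3 ln n.\<close>

lemma prob_large_eigenvalue_dense:
  fixes p \<eta> :: real and n :: nat
  assumes p: "0 \<le> p" "p \<le> 1" and n: "n > 0" and \<eta>: "0 < \<eta>" "\<eta> \<le> 1"
    and dense: "32 / \<eta>\<^sup>2 * ln n \<le> n * p"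
  shows "measure_pmf.prob (gnp n p)
      {G. (1 + \<eta>) * spectral_scale n p G < largest_eigenvalue n G} \<le> 1 / n"
proof -
  define d where "d = n * p"
  have d0: "d \<ge> 0" using p by (simp add: d_def)
  have "measure_pmf.prob (gnp n p) {G. (1 + \<eta>) * spectral_scale n p G < largest_eigenvalue n G}
      \<le> measure_pmf.prob (gnp n p) (\<Union>v\<in>{1..n}. {G. (1 + \<eta>) * d \<le> card (nbr G v)})"
  proof (rule gnp_prob_mono)
    fix G assume G: "G \<subseteq> possible_edges n" "G \<in> {G. (1 + \<eta>) * spectral_scale n p G < largest_eigenvalue n G}"
    have "(1 + \<eta>) * d \<le> (1 + \<eta>) * spectral_scale n p G"
      using \<eta> by (intro mult_left_mono) (auto simp: d_def spectral_scale_def)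
    also have "\<dots> \<le> max_degree n G" using G largest_eigenvalue_le_max_degree[OF G(1) n] by auto
    finally have "(1 + \<eta>) * d \<le> max_degree n G" .
    moreover obtain v where v: "v \<in> {1..n}" "card (nbr G v) = max_degree n G"
      by (rule max_degree_attained[OF G(1) n])
    ultimately show "G \<in> (\<Union>v\<in>{1..n}. {G. (1 + \<eta>) * d \<le> card (nbr G v)})"
      by (intro UN_I[OF v(1)]) (simp add: v(2))
  qed
  also have "\<dots> \<le> card {1..n} * exp (- (2 * ln n))"
  proof (rule gnp_prob_UN_le)
    fix v assume v: "v \<in> {1..n}"
    have "measure_pmf.prob (gnp n p) {G. (1 + \<eta>) * d \<le> card (nbr G v)}
        \<le> exp (d * ((exp (2 * (\<eta> / 8)) - 1) / 2) - \<eta> / 8 * ((1 + \<eta>) * d))"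
      unfolding d_def using \<eta> by (intro gnp_degree_upper_tail[OF p _ v]) auto
    also have "\<dots> \<le> exp (- (2 * ln n))"
    proof (rule iffD2[OF exp_le_cancel_iff])
      have "d * ((exp (2 * (\<eta> / 8)) - 1) / 2) \<le> d * (\<eta> / 8 * (1 + \<eta> / 4))"
        using d0 half_exp_minus_one_le[OF \<eta>] by (intro mult_left_mono)
      moreover have "d * (\<eta> / 8 * (1 + \<eta> / 4)) - \<eta> / 8 * ((1 + \<eta>) * d) = - (3 / 32 * (\<eta>\<^sup>2 * d))"
        by (simp add: field_simps power2_eq_square)
      moreover have "2 * ln n \<le> 3 / 32 * (\<eta>\<^sup>2 * d)"
      proof -
        have "32 * ln n \<le> \<eta>\<^sup>2 * d" using dense \<eta> by (simp add: d_def field_simps)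
        moreover have "0 \<le> ln (real n)" using n by simp
        ultimately show ?thesis by linarith
      qed
      ultimately show "d * ((exp (2 * (\<eta> / 8)) - 1) / 2) - \<eta> / 8 * ((1 + \<eta>) * d) \<le> - (2 * ln n)"
        by linarith
    qed
    finally show "measure_pmf.prob (gnp n p) {G. (1 + \<eta>) * d \<le> card (nbr G v)} \<le> exp (- (2 * ln n))" .
  qed simp
  also have "\<dots> = 1 / n" using mult_exp_minus_two_ln[OF n] by simp
  finally show ?thesis .
qed

section \<open>Average degree below a multiple of \<open>ln n\<close>\<close>

lemma mgf_condition_constant_tilt:
  fixes d \<eta> y :: real
  assumes \<eta>: "0 < \<eta>" "\<eta> \<le> 1" and d: "0 \<le> d" "d \<le> y"
    and y: "y * exp (\<eta> / 8) * exp (- (\<eta>\<^sup>2 * y / 32)) \<le> ln 2"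
  shows "d * exp (\<eta> / 8) * exp (d * ((exp (2 * (\<eta> / 8)) - 1) / 2) - \<eta> / 8 * ((1 + \<eta> / 2) * y)) \<le> ln 2"
proof -
  have "d * ((exp (2 * (\<eta> / 8)) - 1) / 2) \<le> y * (\<eta> / 8 * (1 + \<eta> / 4))"
    using d \<eta> half_exp_minus_one_le[OF \<eta>] by (intro mult_mono) auto
  moreover have "y * (\<eta> / 8 * (1 + \<eta> / 4)) - \<eta> / 8 * ((1 + \<eta> / 2) * y) = - (\<eta>\<^sup>2 * y / 32)"
    by (simp add: field_simps power2_eq_square)
  ultimately have "d * ((exp (2 * (\<eta> / 8)) - 1) / 2) - \<eta> / 8 * ((1 + \<eta> / 2) * y) \<le> - (\<eta>\<^sup>2 * y / 32)"
    by linarith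
  hence "d * exp (\<eta> / 8) * exp (d * ((exp (2 * (\<eta> / 8)) - 1) / 2) - \<eta> / 8 * ((1 + \<eta> / 2) * y))
      \<le> y * exp (\<eta> / 8) * exp (- (\<eta>\<^sup>2 * y / 32))"
    using d by (intro mult_mono) auto
  thus ?thesis using y by (rule order_trans)
qed

abbreviation large_eigenvalue_event :: "real \<Rightarrow> real \<Rightarrow> nat \<Rightarrow> real \<Rightarrow> nat set set set" where
  "large_eigenvalue_event K \<eta> n p \<equiv>
     {G. K \<le> spectral_scale n p G \<and> (1 + \<eta>) * spectral_scale n p G < largest_eigenvalue n G}"

text \<open>Treated separately because the tilt for small n p involves ln (n p). The graph is almost
  surely empty, so its scale 0 stays below K.\<close>

lemma prob_large_eigenvalue_zero:
  assumes n: "n > 0" and K: "0 < K"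
  shows "measure_pmf.prob (gnp n 0) (large_eigenvalue_event K \<eta> n 0) \<le> 0"
proof -
  have "measure_pmf.prob (gnp n 0) (large_eigenvalue_event K \<eta> n 0)
      \<le> measure_pmf.prob (gnp n 0) (\<Union>e\<in>possible_edges n. {G. {e} \<subseteq> G})"
  proof (rule gnp_prob_mono)
    fix G assume G: "G \<subseteq> possible_edges n" "G \<in> large_eigenvalue_event K \<eta> n 0"
    have "G \<noteq> {}"
    proof
      assume "G = {}"
      hence "max_degree n G = 0" using n by (simp add: max_degree_def image_constant_conv)
      thus False using G(2) K by (simp add: spectral_scale_def)
    qed
    thus "G \<in> (\<Union>e\<in>possible_edges n. {G. {e} \<subseteq> G})" using G(1) by auto
  qed
  also have "\<dots> \<le> card (possible_edges n) * (0 :: real)"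
    by (rule gnp_prob_UN_le) (use gnp_prob_superset[of 0 "{_}" n] in auto)
  finally show ?thesis by simp
qed

text \<open>For \<open>1 / ln n \<le> n p\<close> the exponential tilt \<open>\<theta> = \<eta> / 8\<close> is constant.\<close>

lemma prob_large_eigenvalue_middle:
  fixes \<eta> C K \<delta> :: real
  assumes \<eta>: "0 < \<eta>" "\<eta> \<le> 1" and \<delta>: "\<delta> > 0" and K: "2 / \<eta> \<le> K"
    and tilt: "\<And>y. K \<le> y \<Longrightarrow> y * exp (\<eta> / 8) * exp (- (\<eta>\<^sup>2 * y / 32)) \<le> ln 2"
  shows "\<forall>\<^sub>F n in sequentially. \<forall>p. 0 \<le> p \<and> p \<le> 1 \<and> 1 / ln (real n) \<le> real n * p \<and> real n * p \<le> C * ln (real n) \<longrightarrow>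
    measure_pmf.prob (gnp n p) (large_eigenvalue_event K \<eta> n p) \<le> \<delta>"
proof -
  have "filterlim (\<lambda>n::nat. 1 / real n) (nhds 0) sequentially" by real_asymp
  hence e1: "\<forall>\<^sub>F n in sequentially. 1 / real n < \<delta> / 3"
    using \<delta> by (intro order_tendstoD) auto
  have "(\<lambda>n::nat. ln (real n) ^ 6 / real n) \<longlonglongrightarrow> 0" by real_asymp
  hence "(\<lambda>n::nat. C ^ 6 * (ln (real n) ^ 6 / real n)) \<longlonglongrightarrow> 0" by (rule tendsto_mult_right_zero)
  hence e2: "\<forall>\<^sub>F n in sequentially. C ^ 6 * (ln (real n) ^ 6 / real n) < \<delta> / 3"
    using \<delta> by (intro order_tendstoD) auto
  have "filterlim (\<lambda>n::nat. sqrt (ln (real n))) at_top sequentially" by real_asymp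
  hence e3: "\<forall>\<^sub>F n in sequentially. 128 / \<eta> ^ 3 \<le> sqrt (ln (real n))"
    unfolding filterlim_at_top by blast
  have "filterlim (\<lambda>n::nat. ln (real n) powr (6/5) / (sqrt (ln (real n)) + ln (real n))) at_top sequentially"
    by real_asymp
  hence e4: "\<forall>\<^sub>F n in sequentially. 64 / \<eta> ^ 3 \<le> ln (real n) powr (6/5) / (sqrt (ln (real n)) + ln (real n))"
    unfolding filterlim_at_top by blast
  \<comment> \<open>The outer exponent still has order n^(1 - o(1)), since ln(n)^(4/5) ln ln n and
    sqrt (ln n) are both o(ln n).\<close>
  have "(\<lambda>n::nat. exp (- (real n / 4) * (exp (- (2 * ln (real n) powr (4/5) * ln (2 * (ln (real n))\<^sup>2)))
      * exp (- 2 * sqrt (ln (real n)))))) \<longlonglongrightarrow> 0" by real_asymp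
  hence e5: "\<forall>\<^sub>F n::nat in sequentially. exp (- (real n / 4) * (exp (- (2 * ln (real n) powr (4/5) * ln (2 * (ln (real n))\<^sup>2)))
      * exp (- 2 * sqrt (ln (real n))))) < \<delta> / 3"
    using \<delta> by (intro order_tendstoD) auto
  have e6: "\<forall>\<^sub>F n::nat in sequentially. ln (real n) powr (4/5) + 1 \<le> ln (real n)" by real_asymp
  have e7: "\<forall>\<^sub>F n::nat in sequentially. 2 * ln (real n) \<le> real n" by real_asymp
  have e8: "\<forall>\<^sub>F n::nat in sequentially. 2 \<le> ln (real n)" by real_asymp
  have e9: "\<forall>\<^sub>F n::nat in sequentially. 2 * sqrt (ln (real n)) \<le> real n" by real_asymp
  from e1 e2 e3 e4 e5 e6 e7 e8 e9 show ?thesis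
  proof eventually_elim
    case (elim n)
    define l where "l = ln (real n)"
    have l: "2 \<le> l" using elim(8) by (simp add: l_def)
    have n: "n > 0" using l by (cases "n = 0") (auto simp: l_def)
    have sl: "sqrt l * sqrt l = l" "1 \<le> sqrt l" using l by auto
    have \<eta>3: "\<eta> ^ 3 > 0" using \<eta> by simp
    show ?case
    proof (intro allI impI, elim conjE)
      fix p assume p: "0 \<le> p" "p \<le> 1" and lower: "1 / ln (real n) \<le> real n * p"
        and upper: "real n * p \<le> C * ln (real n)"
      define d where "d = real n * p"
      have d: "0 \<le> d" "1 / l \<le> d" "d \<le> C * l" using p lower upper by (auto simp: d_def l_def)
      have "d ^ 6 \<le> (C * l) ^ 6" using d by (intro power_mono) auto
      hence "d ^ 6 / n \<le> (C * l) ^ 6 / n" by (intro divide_right_mono) auto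
      also have "(C * l) ^ 6 / n = C ^ 6 * (ln (real n) ^ 6 / real n)"
        by (simp add: power_mult_distrib l_def)
      finally have codeg: "(n * p) ^ 6 / n \<le> \<delta> / 3" using elim(2) unfolding d_def by linarith
      \<comment> \<open>From \<open>sqrt l\<close> on, the average degree alone gives y^3 of order
        at least l^(3/2), and D = 0 makes the degree event impossible. Below that, sqrt D gives y^3
        at least l^(6/5).\<close>
      define D where "D = (if sqrt l \<le> d then 0 else nat \<lceil>l powr (4/5)\<rceil>)"
      define y where "y = max K (max (real n * p) (sqrt D))"
      have y: "K \<le> y" "d \<le> y" "sqrt D \<le> y" by (auto simp: y_def d_def)
      have "measure_pmf.prob (gnp n p) (large_eigenvalue_event K \<eta> n p)
        \<le> measure_pmf.prob (gnp n p) {G. max_degree n G < D} + (n * p) ^ 6 / n + 1 / n"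
      proof (rule prob_large_eigenvalue_le[OF p n \<eta>(1) _ y_def K, of "\<eta> / 8"])
        show "0 \<le> \<eta> / 8" using \<eta> by simp
        show "n * p * exp (\<eta> / 8) * exp (n * p * ((exp (2 * (\<eta> / 8)) - 1) / 2) - \<eta> / 8 * ((1 + \<eta> / 2) * y)) \<le> ln 2"
          using mgf_condition_constant_tilt[OF \<eta> d(1) y(2) tilt[OF y(1)]] by (simp only: d_def)
        \<comment> \<open>The required inequality 2 (d + l) \<le> \<theta> \<eta>^2 y^3 / 4 with
          \<theta> = \<eta> / 8, cleared of denominators.\<close>
        have "64 * (d + l) \<le> \<eta> ^ 3 * y ^ 3"
        proof (cases "sqrt l \<le> d")
          case True
          have "l \<le> d * d" using mult_mono[OF True True] sl d(1) by simp
          have "128 \<le> \<eta> ^ 3 * sqrt l" using elim(3) \<eta>3 by (simp add: l_def field_simps)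
          also have "\<dots> \<le> \<eta> ^ 3 * d" using True \<eta>3 by (intro mult_left_mono) auto
          finally have c: "128 \<le> \<eta> ^ 3 * d" .
          have "1 \<le> d" using True sl by linarith
          hence "d * 1 \<le> d * d" by (intro mult_left_mono) auto
          hence "64 * (d + l) \<le> 128 * (d * d)" using \<open>l \<le> d * d\<close>
            unfolding distrib_left by linarith
          also have "\<dots> \<le> \<eta> ^ 3 * d * (d * d)" using c by (intro mult_right_mono) auto
          also have "\<dots> = \<eta> ^ 3 * d ^ 3" by (simp add: power3_eq_cube)
          also have "\<dots> \<le> \<eta> ^ 3 * y ^ 3" using y(2) d(1) \<eta>3 by (intro mult_left_mono power_mono) auto
          finally show ?thesis .
        next
          case False
          have "l powr (4/5) \<le> D" using False by (simp add: D_def)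
          hence "sqrt (l powr (4/5)) \<le> sqrt D" by (rule real_sqrt_le_mono)
          hence "sqrt (l powr (4/5)) \<le> y" using y(3) by (rule order_trans)
          moreover have "sqrt (l powr (4/5)) = l powr (2/5)" using l by (simp add: powr_half_sqrt[symmetric] powr_powr)
          ultimately have "(l powr (2/5)) ^ 3 \<le> y ^ 3" by (intro power_mono) auto
          moreover have "(l powr (2/5)) ^ 3 = l powr (6/5)"
            using l by (simp add: powr_power)
          ultimately have "\<eta> ^ 3 * l powr (6/5) \<le> \<eta> ^ 3 * y ^ 3" using \<eta>3 by (intro mult_left_mono) auto
          moreover have "64 * (sqrt l + l) \<le> \<eta> ^ 3 * l powr (6/5)"
          proof -
            have pos: "sqrt l + l > 0" using l sl by linarith
            have "64 / \<eta> ^ 3 * (sqrt l + l) \<le> l powr (6/5)"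
              using elim(4) pos unfolding l_def[symmetric] by (simp only: pos_le_divide_eq)
            hence "\<eta> ^ 3 * (64 / \<eta> ^ 3 * (sqrt l + l)) \<le> \<eta> ^ 3 * l powr (6/5)"
              using \<eta>3 by (intro mult_left_mono) auto
            thus ?thesis using \<eta> by simp
          qed
          ultimately show ?thesis using False by simp
        qed
        thus "2 * (n * p) + 2 * ln n \<le> \<eta> / 8 * (\<eta>\<^sup>2 * y ^ 3 / 4)"
          by (simp add: d_def l_def power2_eq_square power3_eq_cube)
      qed
      moreover have "measure_pmf.prob (gnp n p) {G. max_degree n G < D} \<le> \<delta> / 3"
      proof (cases "sqrt l \<le> d")
        case True
        thus ?thesis using \<delta> by (simp add: D_def)
      next
        case False
        have p_half: "p \<le> 1 / 2"
        proof -
          have "2 * d \<le> n" using False elim(9) by (simp add: l_def)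
          thus ?thesis using n by (simp add: d_def field_simps)
        qed
        have pl: "1 \<le> l powr (4/5)" using l by (intro ge_one_powr_ge_zero) auto
        have Dl: "l powr (4/5) \<le> D" "D \<le> l powr (4/5) + 1"
          using False by (simp_all add: D_def)
        have Dle: "D \<le> l" using Dl(2) elim(6) by (simp add: l_def)
        have D1: "1 \<le> D" using pl Dl(1) by linarith
        have n2: "2 * D \<le> n" using Dle elim(7) by (simp add: l_def)
        \<comment> \<open>A lower bound for d / (2 D), from 1 / l \<le> d and D \<le> l.\<close>
        define b where "b = 1 / (2 * l\<^sup>2)"
        have b: "0 < b" "b \<le> 1" using l by (auto simp: b_def power2_eq_square mult_le_one intro!: mult_ge1_I)
        have "b \<le> d / (2 * real D)"
        proof -
          have "b = (1 / l) / (2 * l)" by (simp add: b_def power2_eq_square)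
          also have "\<dots> \<le> d / (2 * real D)" using d Dle D1 l by (intro frac_le) auto
          finally show ?thesis .
        qed
        hence "b ^ D \<le> (d / (2 * real D)) ^ D" using b by (intro power_mono) auto
        moreover have "exp (- (2 * l powr (4/5) * ln (2 * l\<^sup>2))) \<le> b ^ D"
        proof -
          have "b = exp (- ln (2 * l\<^sup>2))" using l by (simp add: b_def exp_minus inverse_eq_divide)
          hence "b ^ D = exp (- (D * ln (2 * l\<^sup>2)))" by (simp add: exp_of_nat_mult[symmetric])
          moreover have "D * ln (2 * l\<^sup>2) \<le> 2 * l powr (4/5) * ln (2 * l\<^sup>2)"
          proof (rule mult_right_mono)
            have "1 \<le> 2 * l\<^sup>2" using b l by (simp add: b_def)
            thus "0 \<le> ln (2 * l\<^sup>2)" by simp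
            show "D \<le> 2 * l powr (4/5)" using Dl pl by linarith
          qed
          ultimately show ?thesis by simp
        qed
        moreover have "exp (- 2 * sqrt l) \<le> exp (- 2 * d)" using False by simp
        ultimately have "exp (- (2 * l powr (4/5) * ln (2 * l\<^sup>2))) * exp (- 2 * sqrt l)
            \<le> (d / (2 * real D)) ^ D * exp (- 2 * d)"
          using d by (intro mult_mono) auto
        hence "- (n / 4) * ((d / (2 * real D)) ^ D * exp (- 2 * d))
            \<le> - (n / 4) * (exp (- (2 * l powr (4/5) * ln (2 * l\<^sup>2))) * exp (- 2 * sqrt l))"
          by (intro mult_left_mono_neg) auto
        hence "exp (- (n / 4) * ((d / (2 * real D)) ^ D * exp (- 2 * d)))
            \<le> exp (- (n / 4) * (exp (- (2 * l powr (4/5) * ln (2 * l\<^sup>2))) * exp (- 2 * sqrt l)))" by (rule iffD2[OF exp_le_cancel_iff])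
        moreover have "measure_pmf.prob (gnp n p) {G. max_degree n G < D}
            \<le> exp (- (n / 4) * ((d / (2 * real D)) ^ D * exp (- 2 * d)))"
          unfolding d_def by (rule gnp_max_degree_lower_tail[OF p(1) p_half]) (use n2 D1 in simp_all)
        ultimately have "measure_pmf.prob (gnp n p) {G. max_degree n G < D}
            \<le> exp (- (n / 4) * (exp (- (2 * l powr (4/5) * ln (2 * l\<^sup>2))) * exp (- 2 * sqrt l)))"
          by linarith
        thus ?thesis using elim(5) unfolding l_def by linarith
      qed
      ultimately show "measure_pmf.prob (gnp n p) (large_eigenvalue_event K \<eta> n p) \<le> \<delta>"
        using codeg elim(1) by linarith
    qed
  qed
qed

text \<open>For \<open>n p < 1 / ln n\<close> the tilt is \<open>\<theta> = - ln (n p) / 2\<close>, so that \<open>n p exp (2 \<theta>) = 1\<close>.\<close>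

lemma prob_large_eigenvalue_sparse:
  fixes \<eta> K \<delta> :: real
  assumes \<eta>: "0 < \<eta>" "\<eta> \<le> 1" and \<delta>: "\<delta> > 0" and K: "2 / \<eta> \<le> K" "272 / \<eta>\<^sup>2 \<le> K"
  shows "\<forall>\<^sub>F n in sequentially. \<forall>p. 0 < p \<and> p \<le> 1 \<and> real n * p < 1 / ln (real n) \<longrightarrow>
    measure_pmf.prob (gnp n p) (large_eigenvalue_event K \<eta> n p) \<le> \<delta>"
proof -
  have "filterlim (\<lambda>n::nat. 1 / real n) (nhds 0) sequentially" by real_asymp
  hence e1: "\<forall>\<^sub>F n in sequentially. 1 / real n < \<delta> / 3"
    using \<delta> by (intro order_tendstoD) auto
  have "(\<lambda>n::nat. exp (- (real n / 4) * (exp (- (ln (real n) / 4)) * exp (- 2)))) \<longlonglongrightarrow> 0" by real_asymp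
  hence e2: "\<forall>\<^sub>F n::nat in sequentially. exp (- (real n / 4) * (exp (- (ln (real n) / 4)) * exp (- 2))) < \<delta> / 3"
    using \<delta> by (intro order_tendstoD) auto
  have "(\<lambda>n::nat. exp (1 / 2 - ln (ln (real n)) / 2)) \<longlonglongrightarrow> 0" by real_asymp
  hence e3: "\<forall>\<^sub>F n::nat in sequentially. exp (1 / 2 - ln (ln (real n)) / 2) < ln 2"
    by (intro order_tendstoD) auto
  have e4: "\<forall>\<^sub>F n::nat in sequentially. 2 * ln (real n) \<le> real n" by real_asymp
  have e5: "\<forall>\<^sub>F n::nat in sequentially. 1 \<le> ln (ln (real n))" by real_asymp
  have e6: "\<forall>\<^sub>F n::nat in sequentially. 2 \<le> ln (real n)" by real_asymp
  from e1 e2 e3 e4 e5 e6 show ?thesis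
  proof eventually_elim
    case (elim n)
    define l where "l = ln (real n)"
    have l: "2 \<le> l" using elim(6) by (simp add: l_def)
    have n: "n > 0" using l by (cases "n = 0") (auto simp: l_def)
    have n2: "2 \<le> n" using l elim(4) by (simp add: l_def)
    show ?case
    proof (intro allI impI, elim conjE)
      fix p assume p0: "0 < p" and p1: "p \<le> 1" and upper: "real n * p < 1 / ln (real n)"
      have p: "0 \<le> p" "p \<le> 1" using p0 p1 by auto
      define d where "d = real n * p"
      have "1 / l \<le> 1 / 2" using l by (simp add: field_simps)
      hence d: "0 < d" "d < 1 / l" "d \<le> 1 / 2" "d \<le> 1" using p0 n upper by (auto simp: d_def l_def)
      define m where "m = - ln d"
      have dm: "d = exp (- m)" using d by (simp add: m_def)
      have "ln d < ln (1 / l)" using d l by (subst ln_less_cancel_iff) auto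
      hence ml: "ln l \<le> m" using l by (simp add: m_def ln_div)
      have m1: "1 \<le> m" using ml elim(5) by (simp add: l_def)
      \<comment> \<open>With 8 m D \<le> l, a vertex has degree D with probability at least of order
        exp (- 2 m D), hence n^(-1/4). The floor may be 0; then y \<ge> 1 makes up for the
        rounding.\<close>
      define D where "D = nat \<lfloor>l / (8 * m)\<rfloor>"
      have Dl: "D \<le> l / (8 * m)" "l / (8 * m) \<le> real D + 1"
        using l m1 by (simp_all add: D_def)
      define y where "y = max K (max (real n * p) (sqrt D))"
      have y: "K \<le> y" "d \<le> y" "sqrt D \<le> y" by (auto simp: y_def d_def)
      have "2 \<le> 2 / \<eta>" using \<eta> by (simp add: field_simps)
      hence y1: "1 \<le> y" using K y by linarith
      have "d ^ 6 \<le> 1" using d by (intro power_le_one) auto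
      hence "d ^ 6 / n \<le> 1 / n" by (intro divide_right_mono) auto
      hence codeg: "(n * p) ^ 6 / n \<le> \<delta> / 3" using elim(1) unfolding d_def by linarith
      have tilt: "d * exp (2 * (m / 2)) = 1" using dm by (simp add: mult_exp_exp)
      have "measure_pmf.prob (gnp n p) (large_eigenvalue_event K \<eta> n p)
        \<le> measure_pmf.prob (gnp n p) {G. max_degree n G < D} + (n * p) ^ 6 / n + 1 / n"
      proof (rule prob_large_eigenvalue_le[OF p n \<eta>(1) _ y_def K(1), of "m / 2"])
        show "0 \<le> m / 2" using m1 by simp
        have "d * ((exp (2 * (m / 2)) - 1) / 2) = (1 - d) / 2"
          using tilt by (simp add: field_simps)
        also have "\<dots> \<le> 1 / 2" using d by simp
        finally have "d * ((exp (2 * (m / 2)) - 1) / 2) \<le> 1 / 2" .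
        moreover have "0 \<le> m / 2 * ((1 + \<eta> / 2) * y)" using m1 \<eta> y1 by (intro mult_nonneg_nonneg) auto
        ultimately have "d * ((exp (2 * (m / 2)) - 1) / 2) - m / 2 * ((1 + \<eta> / 2) * y) \<le> 1 / 2" by linarith
        hence "d * exp (m / 2) * exp (d * ((exp (2 * (m / 2)) - 1) / 2) - m / 2 * ((1 + \<eta> / 2) * y))
            \<le> d * exp (m / 2) * exp (1 / 2)"
          using d by (intro mult_left_mono) auto
        also have "\<dots> = exp (1 / 2 - m / 2)" unfolding dm mult_exp_exp by simp
        also have "\<dots> \<le> exp (1 / 2 - ln (ln (real n)) / 2)" using ml by (simp add: l_def)
        also have "\<dots> \<le> ln 2" using elim(3) by simp
        finally show "n * p * exp (m / 2) * exp (n * p * ((exp (2 * (m / 2)) - 1) / 2) - m / 2 * ((1 + \<eta> / 2) * y)) \<le> ln 2"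
          by (simp only: d_def)
        have "1 * 1 \<le> y * y" using y1 by (intro mult_mono) auto
        hence yy: "1 \<le> y * y" by simp
        have "sqrt D * sqrt D \<le> y * y" using y y1 by (intro mult_mono) auto
        hence "D \<le> y * y" by simp
        hence "l / (8 * m) \<le> 2 * (y * y)" using Dl(2) yy by linarith
        hence ly: "l \<le> 16 * (m * (y * y))" using m1 by (simp add: field_simps)
        have "1 * 1 \<le> m * (y * y)" using m1 yy by (intro mult_mono) auto
        \<comment> \<open>34 = 2 + 2 * 16, from d \<le> 1 \<le> m y^2 and l \<le> 16 m y^2; the
          bound 272 = 8 * 34 on K absorbs it.\<close>
        hence "2 * d + 2 * l \<le> 34 * (m * (y * y))" using ly d by linarith
        also have "\<dots> \<le> (\<eta>\<^sup>2 * y / 8) * (m * (y * y))"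
        proof (rule mult_right_mono)
          have "272 / \<eta>\<^sup>2 \<le> y" using K y by linarith
          thus "34 \<le> \<eta>\<^sup>2 * y / 8" using \<eta> by (simp add: field_simps)
          show "0 \<le> m * (y * y)" using m1 by simp
        qed
        also have "\<dots> = m / 2 * (\<eta>\<^sup>2 * y ^ 3 / 4)" by (simp add: power3_eq_cube)
        finally show "2 * (n * p) + 2 * ln n \<le> m / 2 * (\<eta>\<^sup>2 * y ^ 3 / 4)" by (simp add: d_def l_def)
      qed
      moreover have "measure_pmf.prob (gnp n p) {G. max_degree n G < D} \<le> \<delta> / 3"
      proof (cases "D = 0")
        case True
        thus ?thesis using \<delta> by simp
      next
        case False
        hence D1: "1 \<le> D" by simp
        have Dm: "8 * (m * D) \<le> l" using Dl(1) m1 by (simp add: field_simps)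
        have "1 * real D \<le> m * real D" using m1 by (intro mult_right_mono) auto
        hence Dle: "2 * real D \<le> l" using Dm l by linarith
        hence n2D: "2 * D \<le> n" using elim(4) l by (simp add: l_def)
        have p_half: "p \<le> 1 / 2"
        proof -
          have "1 * p \<le> n * p" using n p by (intro mult_right_mono) auto
          thus ?thesis using d by (simp add: d_def)
        qed
        \<comment> \<open>The left side is d^2; the claim rests on 2 D \<le> l \<le> exp m = 1 /
          d.\<close>
        have "exp (- (2 * m)) \<le> d / (2 * real D)"
        proof -
          have "exp (- (2 * m)) = d * exp (- m)" unfolding dm mult_exp_exp by simp
          also have "\<dots> \<le> d * exp (- ln (2 * real D))"
          proof -
            have "ln (2 * real D) \<le> ln l" using D1 Dle by (subst ln_le_cancel_iff) auto
            thus ?thesis using ml d by simp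
          qed
          also have "\<dots> = d / (2 * real D)" using D1 by (simp add: exp_minus inverse_eq_divide)
          finally show ?thesis .
        qed
        hence "exp (- (2 * m)) ^ D \<le> (d / (2 * real D)) ^ D" by (intro power_mono) auto
        moreover have "exp (- (l / 4)) \<le> exp (- (2 * m)) ^ D"
          using Dm by (simp add: exp_of_nat_mult[symmetric] mult_ac)
        moreover have "exp (- 2) \<le> exp (- 2 * d)" using d by simp
        ultimately have "exp (- (l / 4)) * exp (- 2) \<le> (d / (2 * real D)) ^ D * exp (- 2 * d)"
          using d by (intro mult_mono) auto
        hence "- (n / 4) * ((d / (2 * real D)) ^ D * exp (- 2 * d)) \<le> - (n / 4) * (exp (- (l / 4)) * exp (- 2))"
          by (intro mult_left_mono_neg) auto
        hence "exp (- (n / 4) * ((d / (2 * real D)) ^ D * exp (- 2 * d)))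
            \<le> exp (- (n / 4) * (exp (- (l / 4)) * exp (- 2)))" by (rule iffD2[OF exp_le_cancel_iff])
        moreover have "measure_pmf.prob (gnp n p) {G. max_degree n G < D}
            \<le> exp (- (n / 4) * ((d / (2 * real D)) ^ D * exp (- 2 * d)))"
          unfolding d_def by (rule gnp_max_degree_lower_tail[OF p(1) p_half n2 D1 n2D])
        ultimately have "measure_pmf.prob (gnp n p) {G. max_degree n G < D}
            \<le> exp (- (n / 4) * (exp (- (l / 4)) * exp (- 2)))"
          by linarith
        thus ?thesis using elim(2) unfolding l_def by linarith
      qed
      ultimately show "measure_pmf.prob (gnp n p) (large_eigenvalue_event K \<eta> n p) \<le> \<delta>"
        using codeg elim(1) by linarith
    qed
  qed
qed

text \<open>The order of quantifiers matters: K depends on \<eta> alone, while only the required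
  size of n depends on \<delta>, and neither depends on p.\<close>

lemma prob_large_eigenvalue_eventually_small:
  fixes \<eta> :: real
  assumes \<eta>: "0 < \<eta>" "\<eta> \<le> 1"
  obtains K where "K \<ge> 1" "\<And>\<delta>. \<delta> > 0 \<Longrightarrow> \<forall>\<^sub>F n in sequentially. \<forall>p. 0 \<le> p \<and> p \<le> 1 \<longrightarrow>
    measure_pmf.prob (gnp n p) (large_eigenvalue_event K \<eta> n p) \<le> \<delta>"
proof -
  define c where "c = \<eta>\<^sup>2 / 32"
  have c: "c > 0" using \<eta> by (simp add: c_def)
  have "((\<lambda>y. y * exp (- (c * y))) \<longlongrightarrow> 0) at_top" using c by real_asymp
  hence "((\<lambda>y. exp (\<eta> / 8) * (y * exp (- (c * y)))) \<longlongrightarrow> 0) at_top" by (rule tendsto_mult_right_zero)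
  hence "\<forall>\<^sub>F y in at_top. exp (\<eta> / 8) * (y * exp (- (c * y))) < ln 2"
    by (rule order_tendstoD) simp
  then obtain K0 where K0: "\<And>y. K0 \<le> y \<Longrightarrow> exp (\<eta> / 8) * (y * exp (- (c * y))) < ln 2"
    unfolding eventually_at_top_linorder by blast
  \<comment> \<open>\<open>K0\<close> serves the constant tilt, 2 / \<eta> the supersolution and 272
    / \<eta>^2 the sparse regime.\<close>
  define K where "K = max K0 (max (2 / \<eta>) (272 / \<eta>\<^sup>2))"
  have K: "K0 \<le> K" "2 / \<eta> \<le> K" "272 / \<eta>\<^sup>2 \<le> K" by (auto simp: K_def)
  have "2 \<le> 2 / \<eta>" using \<eta> by (simp add: field_simps)
  hence K1: "1 \<le> K" using K by linarith
  have tilt: "y * exp (\<eta> / 8) * exp (- (\<eta>\<^sup>2 * y / 32)) \<le> ln 2" if "K \<le> y" for y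
    using K0[of y] K that by (simp add: c_def mult_ac)
  have "\<forall>\<^sub>F n in sequentially. \<forall>p. 0 \<le> p \<and> p \<le> 1 \<longrightarrow>
    measure_pmf.prob (gnp n p) (large_eigenvalue_event K \<eta> n p) \<le> \<delta>" if \<delta>: "\<delta> > 0" for \<delta>
  proof -
    have "filterlim (\<lambda>n::nat. 1 / real n) (nhds 0) sequentially" by real_asymp
    hence e1: "\<forall>\<^sub>F n in sequentially. 1 / real n < \<delta>"
      using \<delta> by (intro order_tendstoD) auto
    have e2: "\<forall>\<^sub>F n in sequentially. \<forall>p. 0 \<le> p \<and> p \<le> 1 \<and> 1 / ln (real n) \<le> real n * p
        \<and> real n * p \<le> 32 / \<eta>\<^sup>2 * ln (real n) \<longrightarrow>
        measure_pmf.prob (gnp n p) (large_eigenvalue_event K \<eta> n p) \<le> \<delta>"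
      by (rule prob_large_eigenvalue_middle[OF \<eta> \<delta> K(2)]) (rule tilt)
    from e1 eventually_gt_at_top[of 0] prob_large_eigenvalue_sparse[OF \<eta> \<delta> K(2,3)] e2
    show ?thesis
    proof eventually_elim
      case (elim n)
      show ?case
      proof (intro allI impI, elim conjE)
        fix p :: real assume p: "0 \<le> p" "p \<le> 1"
        consider "p = 0" | "0 < p" "real n * p < 1 / ln (real n)"
          | "1 / ln (real n) \<le> real n * p" "real n * p \<le> 32 / \<eta>\<^sup>2 * ln (real n)"
          | "32 / \<eta>\<^sup>2 * ln (real n) \<le> real n * p"
          using p by linarith
        thus "measure_pmf.prob (gnp n p) (large_eigenvalue_event K \<eta> n p) \<le> \<delta>"
        proof cases
          case 1
          thus ?thesis using prob_large_eigenvalue_zero[OF elim(2), of K \<eta>] K1 \<delta> by simp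
        next
          case 2
          thus ?thesis using elim(3) p by blast
        next
          case 3
          thus ?thesis using elim(4) p by blast
        next
          case 4
          have "measure_pmf.prob (gnp n p) (large_eigenvalue_event K \<eta> n p)
              \<le> measure_pmf.prob (gnp n p) {G. (1 + \<eta>) * spectral_scale n p G < largest_eigenvalue n G}"
            by (rule gnp_prob_mono) auto
          also have "\<dots> \<le> 1 / n" by (rule prob_large_eigenvalue_dense[OF p elim(2) \<eta> 4])
          finally show ?thesis using elim(1) by simp
        qed
      qed
    qed
  qed
  with K1 show thesis by (rule that)
qed

section \<open>Concentration of the largest eigenvalue\<close>

text \<open>The bound by sqrt \<Delta> is deterministic, so failure forces the scale to be n p and
  the average degree to be too small. Then n p \<ge> 1 makes the tail bound uniform in p.\<close>

lemma prob_small_eigenvalue_le: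
  fixes p \<eta> :: real and n :: nat
  assumes p: "0 \<le> p" "p \<le> 1" and \<eta>: "0 < \<eta>" "\<eta> \<le> 1" and n: "n > 0" "4 / \<eta> \<le> n"
  shows "measure_pmf.prob (gnp n p)
      {G. 1 \<le> spectral_scale n p G \<and> largest_eigenvalue n G < (1 - \<eta>) * spectral_scale n p G}
    \<le> exp (- (n * \<eta>\<^sup>2 / 32))" (is "?P \<le> _")
proof -
  have np: "spectral_scale n p G = n * p" "2 * card G / n < (1 - \<eta>) * (n * p)"
    if "G \<subseteq> possible_edges n" "largest_eigenvalue n G < (1 - \<eta>) * spectral_scale n p G" for G
  proof -
    have "(1 - \<eta>) * sqrt (max_degree n G) \<le> 1 * sqrt (max_degree n G)"
      using \<eta> by (intro mult_right_mono) auto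
    also have "\<dots> \<le> largest_eigenvalue n G"
      using sqrt_max_degree_le_largest_eigenvalue[OF that(1) n(1)] by simp
    finally have "spectral_scale n p G \<noteq> sqrt (max_degree n G)" using that(2) by auto
    thus "spectral_scale n p G = n * p" by (simp add: spectral_scale_def max_def split: if_splits)
    thus "2 * card G / n < (1 - \<eta>) * (n * p)"
      using average_degree_le_largest_eigenvalue[OF that(1) n(1)] that(2) by simp
  qed
  show ?thesis
  proof (cases "1 \<le> n * p")
    case True
    have "?P \<le> measure_pmf.prob (gnp n p) {G. 2 * card G / n < (1 - \<eta>) * (n * p)}"
      by (rule gnp_prob_mono) (use np(2) in auto)
    also have "\<dots> \<le> exp (- (n * (n * p) * \<eta>\<^sup>2 / 32))"
      by (rule gnp_average_degree_lower_tail[OF p \<eta> n(2)])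
    also have "\<dots> \<le> exp (- (n * \<eta>\<^sup>2 / 32))"
    proof -
      have "real n * 1 * \<eta>\<^sup>2 \<le> n * (n * p) * \<eta>\<^sup>2"
        using True by (intro mult_right_mono mult_left_mono) auto
      thus ?thesis by simp
    qed
    finally show ?thesis .
  next
    case False
    have "?P \<le> measure_pmf.prob (gnp n p) {}"
      by (rule gnp_prob_mono) (use np(1) False in auto)
    thus ?thesis by (simp add: order_trans[OF _ exp_ge_zero])
  qed
qed

abbreviation deviation_event :: "real \<Rightarrow> real \<Rightarrow> nat \<Rightarrow> real \<Rightarrow> nat set set set" where
  "deviation_event K \<eta> n p \<equiv> {G. K \<le> spectral_scale n p G \<and>
     \<eta> * spectral_scale n p G < \<bar>largest_eigenvalue n G - spectral_scale n p G\<bar>}"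

lemma prob_deviation_eventually_small:
  fixes \<eta> :: real
  assumes \<eta>: "0 < \<eta>" "\<eta> \<le> 1"
  shows "\<exists>K\<ge>1. \<forall>\<delta>>0. \<forall>\<^sub>F n in sequentially. \<forall>p. 0 \<le> p \<and> p \<le> 1 \<longrightarrow>
    measure_pmf.prob (gnp n p) (deviation_event K \<eta> n p) \<le> \<delta>"
proof -
  obtain K where K: "K \<ge> 1" and up: "\<And>\<delta>. \<delta> > 0 \<Longrightarrow> \<forall>\<^sub>F n in sequentially. \<forall>p. 0 \<le> p \<and> p \<le> 1 \<longrightarrow>
    measure_pmf.prob (gnp n p) (large_eigenvalue_event K \<eta> n p) \<le> \<delta>"
    by (rule prob_large_eigenvalue_eventually_small[OF \<eta>]) blast
  have "\<forall>\<^sub>F n in sequentially. \<forall>p. 0 \<le> p \<and> p \<le> 1 \<longrightarrow>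
    measure_pmf.prob (gnp n p) (deviation_event K \<eta> n p) \<le> \<delta>" if \<delta>: "\<delta> > 0" for \<delta>
  proof -
    define c where "c = \<eta>\<^sup>2 / 32"
    have c: "c > 0" using \<eta> by (simp add: c_def)
    have "(\<lambda>n::nat. exp (- (real n * c))) \<longlonglongrightarrow> 0" using c by real_asymp
    hence e1: "\<forall>\<^sub>F n in sequentially. exp (- (real n * c)) < \<delta> / 2"
      using \<delta> by (intro order_tendstoD) auto
    have "filterlim real at_top sequentially" by (rule filterlim_real_sequentially)
    hence e2: "\<forall>\<^sub>F n in sequentially. 4 / \<eta> \<le> real n" unfolding filterlim_at_top by blast
    have "\<delta> / 2 > 0" using \<delta> by simp
    from e1 e2 eventually_gt_at_top[of 0] up[OF this] show ?thesis
    proof eventually_elim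
      case (elim n)
      show ?case
      proof (intro allI impI, elim conjE)
        fix p :: real assume p: "0 \<le> p" "p \<le> 1"
        let ?S = "{G. 1 \<le> spectral_scale n p G \<and> largest_eigenvalue n G < (1 - \<eta>) * spectral_scale n p G}"
        have "measure_pmf.prob (gnp n p) (deviation_event K \<eta> n p)
            \<le> measure_pmf.prob (gnp n p) (large_eigenvalue_event K \<eta> n p \<union> ?S)"
        proof (rule gnp_prob_mono)
          fix G assume G: "G \<in> deviation_event K \<eta> n p"
          show "G \<in> large_eigenvalue_event K \<eta> n p \<union> ?S"
          proof (cases "largest_eigenvalue n G < spectral_scale n p G")
            case True
            thus ?thesis using G K by (simp add: algebra_simps)
          next
            case False
            thus ?thesis using G by (simp add: algebra_simps)
          qed
        qed
        also have "\<dots> \<le> measure_pmf.prob (gnp n p) (large_eigenvalue_event K \<eta> n p)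
            + measure_pmf.prob (gnp n p) ?S"
          by (rule measure_Un_le) auto
        also have "\<dots> \<le> \<delta> / 2 + \<delta> / 2"
        proof (rule add_mono)
          show "measure_pmf.prob (gnp n p) (large_eigenvalue_event K \<eta> n p) \<le> \<delta> / 2"
            using elim(4) p by blast
          have "measure_pmf.prob (gnp n p) ?S \<le> exp (- (n * \<eta>\<^sup>2 / 32))"
            by (rule prob_small_eigenvalue_le[OF p \<eta> elim(3,2)])
          also have "\<dots> \<le> \<delta> / 2" using elim(1) by (simp add: c_def)
          finally show "measure_pmf.prob (gnp n p) ?S \<le> \<delta> / 2" .
        qed
        finally show "measure_pmf.prob (gnp n p) (deviation_event K \<eta> n p) \<le> \<delta>" by simp
      qed
    qed
  qed
  with K show ?thesis by blast
qed

section \<open>One error function for all p\<close>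

lemma relative_error_witness:
  fixes x e a :: real
  assumes "0 \<le> x" "0 \<le> e" "\<bar>a - x\<bar> \<le> e * x"
  shows "\<exists>\<delta>. \<bar>\<delta>\<bar> \<le> e \<and> a = (1 + \<delta>) * x"
proof (cases "x = 0")
  case True
  thus ?thesis using assms by (intro exI[of _ 0]) auto
next
  case False
  hence "x > 0" using assms by simp
  thus ?thesis using assms(3)
    by (intro exI[of _ "(a - x) / x"]) (auto simp: abs_divide divide_le_eq field_simps)
qed

lemma spectral_scale_le:
  assumes "G \<subseteq> possible_edges n" "n > 0" "p \<le> 1"
  shows "spectral_scale n p G \<le> n"
proof -
  have "sqrt (max_degree n G) \<le> sqrt n" using max_degree_le[OF assms(1,2)] by simp
  also have "\<dots> \<le> sqrt (real n * real n)" using assms(2) by (intro real_sqrt_le_mono) simp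
  also have "\<dots> = n" by simp
  finally have "sqrt (max_degree n G) \<le> n" .
  moreover have "n * p \<le> real n * 1" using assms by (intro mult_left_mono) auto
  ultimately show ?thesis by (simp add: spectral_scale_def)
qed

text \<open>A deterministic estimate for scales below the first threshold, where no probabilistic
  one is available; it uses that \<Delta> is at most the square of the scale.\<close>

lemma largest_eigenvalue_crude_deviation:
  assumes G: "G \<subseteq> possible_edges n" "n > 0" and p: "0 \<le> p"
  shows "\<bar>largest_eigenvalue n G - spectral_scale n p G\<bar>
    \<le> max 1 (spectral_scale n p G) * spectral_scale n p G"
proof -
  define x where "x = spectral_scale n p G"
  have x: "0 \<le> x" using p by (simp add: x_def spectral_scale_def le_max_iff_disj)
  have "sqrt (max_degree n G) ^ 2 \<le> x\<^sup>2" by (rule power_mono) (simp_all add: x_def spectral_scale_def)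
  hence "largest_eigenvalue n G \<le> x * x"
    using largest_eigenvalue_le_max_degree[OF G] by (simp add: power2_eq_square)
  moreover have "0 \<le> largest_eigenvalue n G"
    by (rule order_trans[OF _ sqrt_max_degree_le_largest_eigenvalue[OF G]]) simp
  moreover have "1 * x \<le> max 1 x * x" "x * x \<le> max 1 x * x" using x by (intro mult_right_mono; simp)+
  ultimately show ?thesis using x unfolding x_def[symmetric] by linarith
qed

text \<open>The function \<open>\<epsilon>\<close> is a step function with value \<open>1 / (k + 1)\<close> from the threshold \<open>M k\<close> on.
  Since the scale is at most \<open>n\<close>, choosing \<open>M k\<close> at least as large as the number of
  vertices beyond which the \<open>k\<close>-th probability estimate is valid makes \<open>\<epsilon>\<close> independent of \<open>p\<close>.\<close>

theorem theorem1p1: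
  "\<exists>\<epsilon> :: real \<Rightarrow> real. (\<epsilon> \<longlongrightarrow> 0) at_top \<and>
    (\<forall>p :: nat \<Rightarrow> real. (\<forall>n. 0 \<le> p n \<and> p n \<le> 1) \<longrightarrow>
      (\<lambda>n. measure_pmf.prob (gnp n (p n))
        {G. \<exists>\<delta>. \<bar>\<delta>\<bar> \<le> \<epsilon> (max (sqrt (real (max_degree n G))) (real n * p n)) \<and>
             largest_eigenvalue n G =
               (1 + \<delta>) * max (sqrt (real (max_degree n G))) (real n * p n)})
      \<longlonglongrightarrow> 1)"
proof -
  define \<eta> where "\<eta> = (\<lambda>k. 1 / real (Suc k))"
  have \<eta>: "0 < \<eta> k" "\<eta> k \<le> 1" for k by (simp_all add: \<eta>_def)
  have \<eta>_mono: "\<eta> k \<le> \<eta> j" if "j \<le> k" for j k using that by (simp add: \<eta>_def frac_le)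
  have "\<forall>k. \<exists>K\<ge>1. \<forall>\<delta>>0. \<forall>\<^sub>F n in sequentially. \<forall>p. 0 \<le> p \<and> p \<le> 1 \<longrightarrow>
      measure_pmf.prob (gnp n p) (deviation_event K (\<eta> k) n p) \<le> \<delta>"
    by (intro allI prob_deviation_eventually_small \<eta>)
  from choice[OF this] obtain K where KK: "\<forall>k. 1 \<le> K k \<and> (\<forall>\<delta>>0. \<forall>\<^sub>F n in sequentially. \<forall>p. 0 \<le> p \<and> p \<le> 1 \<longrightarrow>
      measure_pmf.prob (gnp n p) (deviation_event (K k) (\<eta> k) n p) \<le> \<delta>)"
    by (elim exE)
  note K1 = KK[THEN spec, THEN conjunct1] and K = KK[THEN spec, THEN conjunct2, rule_format]
  \<comment> \<open>The square is for the union bound: the k + 1 events up to level k have total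
    probability at most (k + 1) (\<eta> k)^2 = \<eta> k.\<close>
  have "\<forall>k. \<exists>N. \<forall>n\<ge>N. \<forall>i\<in>{..k}. \<forall>p. 0 \<le> p \<and> p \<le> 1 \<longrightarrow>
      measure_pmf.prob (gnp n p) (deviation_event (K i) (\<eta> i) n p) \<le> (\<eta> k)\<^sup>2"
  proof
    fix k
    have "(\<eta> k)\<^sup>2 > 0" using \<eta>(1)[of k] by simp
    hence "\<forall>\<^sub>F n in sequentially. \<forall>i\<in>{..k}. \<forall>p. 0 \<le> p \<and> p \<le> 1 \<longrightarrow>
      measure_pmf.prob (gnp n p) (deviation_event (K i) (\<eta> i) n p) \<le> (\<eta> k)\<^sup>2"
      by (intro eventually_ball_finite ballI K) auto
    thus "\<exists>N. \<forall>n\<ge>N. \<forall>i\<in>{..k}. \<forall>p. 0 \<le> p \<and> p \<le> 1 \<longrightarrow>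
      measure_pmf.prob (gnp n p) (deviation_event (K i) (\<eta> i) n p) \<le> (\<eta> k)\<^sup>2"
      unfolding eventually_sequentially .
  qed
  from choice[OF this] obtain N where NN: "\<forall>k. \<forall>n\<ge>N k. \<forall>i\<in>{..k}. \<forall>p. 0 \<le> p \<and> p \<le> 1 \<longrightarrow>
      measure_pmf.prob (gnp n p) (deviation_event (K i) (\<eta> i) n p) \<le> (\<eta> k)\<^sup>2"
    by (elim exE)
  have N: "measure_pmf.prob (gnp n p) (deviation_event (K i) (\<eta> i) n p) \<le> (\<eta> k)\<^sup>2"
    if "N k \<le> n" "i \<in> {..k}" "0 \<le> p" "p \<le> 1" for k n i p
    using NN[THEN spec, THEN spec, THEN mp, OF that(1), THEN bspec, OF that(2)] that(3,4) by simp
  \<comment> \<open>Summing makes M monotone, and K i \<ge> 1 makes M k at least k, so only finitely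
    many levels lie below a given scale.\<close>
  define M where "M = (\<lambda>k. \<Sum>i\<le>k. K i + real (N i))"
  have KN0: "0 \<le> K i + real (N i)" for i using K1[of i] by simp
  have M_mono: "M j \<le> M k" if "j \<le> k" for j k
    unfolding M_def using that by (intro sum_mono2) (auto simp: KN0)
  have KN_le_M: "K k + real (N k) \<le> M k" for k
    unfolding M_def by (intro member_le_sum) (auto simp: KN0)
  have le_M: "real k \<le> M k" for k
  proof -
    have "(\<Sum>i\<le>k. 1) \<le> M k" unfolding M_def using K1 by (intro sum_mono add_increasing2) auto
    thus ?thesis by simp
  qed
  define A where "A = (\<lambda>x. {k. M k \<le> x})"
  define \<kappa> where "\<kappa> = (\<lambda>x. Max (A x))"
  have finA: "finite (A x)" for x
  proof (rule finite_subset)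
    show "A x \<subseteq> {..nat \<lceil>x\<rceil>}"
    proof
      fix k assume "k \<in> A x"
      hence "real k \<le> x" using le_M[of k] by (simp add: A_def)
      thus "k \<in> {..nat \<lceil>x\<rceil>}" by simp linarith
    qed
  qed simp
  \<comment> \<open>Below \<open>M 0\<close> no level is reached and \<kappa> is meaningless; there
    the factor of the crude deviation bound is used.\<close>
  define \<epsilon> where "\<epsilon> = (\<lambda>x. if x < M 0 then max 1 x else \<eta> (\<kappa> x))"
  have lim: "(\<epsilon> \<longlongrightarrow> 0) at_top"
  proof (rule tendstoI)
    fix r :: real assume "r > 0"
    then obtain j where "1 / real (Suc j) < r" by (rule nat_approx_posE)
    hence j: "\<eta> j < r" by (simp only: \<eta>_def)
    show "\<forall>\<^sub>F x in at_top. dist (\<epsilon> x) 0 < r"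
      unfolding eventually_at_top_linorder
    proof (intro exI allI impI)
      fix x assume x: "M j \<le> x"
      have "j \<le> \<kappa> x" unfolding \<kappa>_def by (rule Max_ge[OF finA]) (simp add: A_def x)
      moreover have "M 0 \<le> x" using M_mono[of 0 j] x by simp
      ultimately have "\<epsilon> x \<le> \<eta> j" "0 \<le> \<epsilon> x"
        using \<eta>_mono[of j "\<kappa> x"] \<eta>(1)[of "\<kappa> x"] by (auto simp: \<epsilon>_def)
      thus "dist (\<epsilon> x) 0 < r" using j by simp
    qed
  qed
  have main: "1 - \<eta> j \<le> measure_pmf.prob (gnp n p) {G. \<exists>\<delta>. \<bar>\<delta>\<bar> \<le> \<epsilon> (spectral_scale n p G) \<and>
      largest_eigenvalue n G = (1 + \<delta>) * spectral_scale n p G}" (is "_ \<le> measure_pmf.prob _ ?good")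
    if p: "0 \<le> p" "p \<le> 1" and n: "0 < n" "j \<le> n" "N j \<le> n" for j n p
  proof -
    \<comment> \<open>The levels whose estimates are available at n; the cap k \<le> n ensures that
      there is a largest one.\<close>
    define S where "S = {k. k \<le> n \<and> N k \<le> n}"
    define k where "k = Max S"
    have finS: "finite S" unfolding S_def by simp
    have jS: "j \<in> S" using n by (simp add: S_def)
    have "k \<in> S" unfolding k_def using finS jS by (intro Max_in) auto
    hence k: "N k \<le> n" by (simp add: S_def)
    have jk: "j \<le> k" unfolding k_def using finS jS by (rule Max_ge)
    have "measure_pmf.prob (gnp n p) (- ?good)
        \<le> measure_pmf.prob (gnp n p) (\<Union>i\<in>{..k}. deviation_event (K i) (\<eta> i) n p)"
    proof (rule gnp_prob_mono)
      fix G assume G: "G \<subseteq> possible_edges n" "G \<in> - ?good"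
      define x where "x = spectral_scale n p G"
      have x0: "0 \<le> x" using p by (simp add: x_def spectral_scale_def le_max_iff_disj)
      have xn: "x \<le> n" unfolding x_def by (rule spectral_scale_le[OF G(1) n(1) p(2)])
      have e0: "0 \<le> \<epsilon> x" using \<eta>(1)[of "\<kappa> x"] x0 by (simp add: \<epsilon>_def le_max_iff_disj)
      have bad: "\<not> \<bar>largest_eigenvalue n G - x\<bar> \<le> \<epsilon> x * x"
        using relative_error_witness[OF x0 e0, of "largest_eigenvalue n G"] G(2) by (auto simp: x_def)
      have "\<not> x < M 0"
        using bad largest_eigenvalue_crude_deviation[OF G(1) n(1) p(1)] by (auto simp: \<epsilon>_def x_def)
      hence x: "0 \<in> A x" and eps: "\<epsilon> x = \<eta> (\<kappa> x)" by (auto simp: A_def \<epsilon>_def)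
      have "\<kappa> x \<in> A x" unfolding \<kappa>_def using finA x by (intro Max_in) auto
      hence Mx: "M (\<kappa> x) \<le> x" by (simp add: A_def)
      \<comment> \<open>Since M (\<kappa> x) \<le> x \<le> n, the level \<kappa> x picked by the
        random scale is among the available ones, and x passes its threshold K.\<close>
      have Kx: "K (\<kappa> x) \<le> x" and Nx: "real (N (\<kappa> x)) \<le> n" and "real (\<kappa> x) \<le> n"
        using Mx KN_le_M[of "\<kappa> x"] K1[of "\<kappa> x"] le_M[of "\<kappa> x"] xn by linarith+
      hence "\<kappa> x \<in> S" by (simp add: S_def)
      hence "\<kappa> x \<le> k" unfolding k_def using finS by (intro Max_ge)
      moreover have "G \<in> deviation_event (K (\<kappa> x)) (\<eta> (\<kappa> x)) n p"
        using bad Kx by (simp add: eps x_def[symmetric])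
      ultimately show "G \<in> (\<Union>i\<in>{..k}. deviation_event (K i) (\<eta> i) n p)" by blast
    qed
    also have "\<dots> \<le> card {..k} * (\<eta> k)\<^sup>2"
      by (rule gnp_prob_UN_le) (auto intro: N[OF k _ p])
    also have "\<dots> = \<eta> k" by (simp add: \<eta>_def power2_eq_square)
    also have "\<dots> \<le> \<eta> j" by (rule \<eta>_mono[OF jk])
    finally show ?thesis
      using measure_pmf.prob_compl[of ?good "gnp n p"] by (simp add: Compl_eq_Diff_UNIV)
  qed
  show ?thesis
  proof (rule exI[of _ \<epsilon>], intro conjI lim allI impI)
    fix p :: "nat \<Rightarrow> real" assume p: "\<forall>n. 0 \<le> p n \<and> p n \<le> 1"
    show "(\<lambda>n. measure_pmf.prob (gnp n (p n))
        {G. \<exists>\<delta>. \<bar>\<delta>\<bar> \<le> \<epsilon> (max (sqrt (real (max_degree n G))) (real n * p n)) \<and>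
             largest_eigenvalue n G =
               (1 + \<delta>) * max (sqrt (real (max_degree n G))) (real n * p n)}) \<longlonglongrightarrow> 1"
      unfolding spectral_scale_def[symmetric]
    proof (rule tendstoI)
      fix r :: real assume "r > 0"
      then obtain j where "1 / real (Suc j) < r" by (rule nat_approx_posE)
      hence j: "\<eta> j < r" by (simp only: \<eta>_def)
      show "\<forall>\<^sub>F n in sequentially. dist (measure_pmf.prob (gnp n (p n))
          {G. \<exists>\<delta>. \<bar>\<delta>\<bar> \<le> \<epsilon> (spectral_scale n (p n) G) \<and>
            largest_eigenvalue n G = (1 + \<delta>) * spectral_scale n (p n) G}) 1 < r"
        using eventually_gt_at_top[of 0] eventually_ge_at_top[of j] eventually_ge_at_top[of "N j"]
      proof eventually_elim
        case (elim n)
        let ?q = "measure_pmf.prob (gnp n (p n)) {G. \<exists>\<delta>. \<bar>\<delta>\<bar> \<le> \<epsilon> (spectral_scale n (p n) G) \<and>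
            largest_eigenvalue n G = (1 + \<delta>) * spectral_scale n (p n) G}"
        have "1 - \<eta> j \<le> ?q" using p elim by (intro main) auto
        moreover have "?q \<le> 1" by (rule measure_pmf.prob_le_1)
        ultimately show ?case using j unfolding dist_real_def by linarith
      qed
    qed
  qed
qed

end
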